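(* Let $1\le d_1\le d_2\le\dots$ and let $D$, $\|\cdot\|_{1D}$ be as in the context. Let $X(t)$ be a continuous-time Markov chain with reduced forward system $\frac{d\mathbf z}{dt}=B(t)\mathbf z(t)+\mathbf f(t)$, where for almost all $t\ge0$ one has $\|B(t)\|_{1D}\le\mathfrak B<\infty$ and $\|\mathbf f(t)\|_{1D}\le\mathfrak f<\infty$. Let $\bar X(t)$ be a perturbed chain on the same state space with corresponding $\bar B(t)$, $\bar{\mathbf f}(t)$, and let $\Delta_B$, $\Delta_f$ be constants such that $\|B(t)-\bar B(t)\|_{1D}\le\Delta_B$ and $\|\mathbf f(t)-\bar{\mathbf f}(t)\|_{1D}\le\Delta_f$ for almost all $t\ge0$. If $X(t)$ is $1D$-exponentially weakly ergodic with constants $M>0$, $a>0$, then $\bar X(t)$ is also $1D$-exponentially weakly ergodic and the following perturbation estimate in the $1D$-norm holds: $$\limsup_{t\to\infty}\|\mathbf p(t)-\bar{\mathbf p}(t)\|_{1D}\le\frac{M\left(M\Delta_B\,\mathfrak f+a\,\Delta_f\right)}{a\left(a-M\Delta_B\right)}.$$ If $W=\inf_{i\ge1}\frac{d_i}{i}>0$, then both chains $X(t)$ and $\bar X(t)$ have limiting means $\phi(t)$, $\bar\phi(t)$, and $$\limsup_{t\to\infty}|\phi(t)-\bar\phi(t)|\le\frac{M\left(M\Delta_B\,\mathfrak f+a\,\Delta_f\right)}{W\,a\left(a-M\Delta_B\right)}.$$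
   Context: $X(t)$, $t\ge0$, is a (generally inhomogeneous) continuous-time Markov chain on $\{0,1,\dots,S\}$, $S\le\infty$, with transition intensities $q_{ij}(t)\ge0$ ($i\ne j$), integrable in $t$ on bounded intervals. Put $a_{ij}(t)=q_{ji}(t)$ for $i\ne j$, $a_{ii}(t)=-\sum_{j\ne i}a_{ji}(t)$, $A(t)=(a_{ij}(t))$, and assume $|a_{ii}(t)|\le L<\infty$ for all $i$ and almost all $t\ge0$. The state probability vector $\mathbf p(t)=(p_0(t),p_1(t),\dots)^T$ satisfies the forward Kolmogorov system $\frac{d\mathbf p}{dt}=A(t)\mathbf p(t)$. Substituting $p_0=1-\sum_{i\ge1}p_i$, the vector $\mathbf z=(p_1,p_2,\dots)^T$ satisfies $\frac{d\mathbf z}{dt}=B(t)\mathbf z(t)+\mathbf f(t)$ with $\mathbf f=(a_{10},a_{20},\dots)^T$ and $B=(a_{ij}-a_{i0})_{i,j\ge1}$. $D$ is the upper triangular matrix with $D_{ij}=d_i$ for $j\ge i\ge1$ and $D_{ij}=0$ for $j<i$. With $\|\mathbf x\|=\sum_i|x_i|$ and $\|B\|=\sup_j\sum_i|b_{ij}|$: $\|\mathbf z\|_{1D}=\|D\mathbf z\|$, $l_{1D}=\{\mathbf z:\|\mathbf z\|_{1D}<\infty\}$, $\|B\|_{1D}=\|DBD^{-1}\|$; for $\mathbf p=(p_0,p_1,p_2,\dots)^T$ one sets $\|\mathbf p\|_{1D}=\|\mathbf z\|_{1D}$ with $\mathbf z=(p_1,p_2,\dots)^T$ (and $\mathbf p\in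 l_{1D}$ means $\mathbf z\in l_{1D}$). $X(t)$ is $1D$-exponentially weakly ergodic (with constants $M>0$, $a>0$) if $\|\mathbf p^*(t)-\mathbf p^{**}(t)\|_{1D}\le Me^{-a(t-s)}\|\mathbf p^*(s)-\mathbf p^{**}(s)\|_{1D}$ for all $t\ge s\ge0$ and any initial conditions $\mathbf p^*(s),\mathbf p^{**}(s)\in l_{1D}$, where $\mathbf p^*(t),\mathbf p^{**}(t)$ are the corresponding solutions of the forward system. The perturbed chain $\bar X(t)$ is a Markov chain of the same type on the same state space; its characteristics are denoted with bars. Initial conditions of the state probability vectors in the $1D$-estimates are taken in $l_{1D}$. With $E(t,k)=E\{X(t)\mid X(0)=k\}$, $X$ has the limiting mean $\phi(t)$ if $|E(t,k)-\phi(t)|\to0$ as $t\to\infty$ for every $k$; similarly for $\bar X$ and $\bar\phi$.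
   Formalization: The smallness condition MΔ_B < a is added; without it the claim fails, e.g. for a two-state chain with unit rates (M=1, a=2) perturbed to zero rates (Δ_B=2): the perturbed chain is not ergodic and the bound's denominator vanishes. *)

theory Defs
  imports "HOL-Probability.Probability"
begin

definition states :: "enat \<Rightarrow> nat set" where
  "states S = {i. enat i \<le> S}"

definition pos_states :: "enat \<Rightarrow> nat set" where
  "pos_states S = {i. 1 \<le> i \<and> enat i \<le> S}"


subsection \<open>Intensities and the forward Kolmogorov system\<close>

text \<open>\<open>q i j t\<close> is the intensity of the transition from \<open>i\<close> to \<open>j\<close> at time \<open>t\<close>; only the
  values with \<open>i \<noteq> j\<close> are used. The generator \<open>A\<close> acts on column vectors, hence the swap of
  indices.\<close>

definition A_mat :: "enat \<Rightarrow> (nat \<Rightarrow> nat \<Rightarrow> real \<Rightarrow> real) \<Rightarrow> real \<Rightarrow> nat \<Rightarrow> nat \<Rightarrow> real" where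
  "A_mat S q t i j = (if i = j then - (\<Sum>\<^sub>\<infinity>k\<in>states S - {i}. q i k t) else q j i t)"

definition B_mat :: "enat \<Rightarrow> (nat \<Rightarrow> nat \<Rightarrow> real \<Rightarrow> real) \<Rightarrow> real \<Rightarrow> nat \<Rightarrow> nat \<Rightarrow> real" where
  "B_mat S q t i j = A_mat S q t i j - A_mat S q t i 0"

definition f_vec :: "enat \<Rightarrow> (nat \<Rightarrow> nat \<Rightarrow> real \<Rightarrow> real) \<Rightarrow> real \<Rightarrow> nat \<Rightarrow> real" where
  "f_vec S q t i = A_mat S q t i 0"

definition prob_vec :: "enat \<Rightarrow> (nat \<Rightarrow> real) \<Rightarrow> bool" where
  "prob_vec S p \<longleftrightarrow> (\<forall>i\<in>states S. 0 \<le> p i) \<and> (p has_sum 1) (states S)"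

text \<open>The intensities are merely locally integrable in time, so \<open>dp/dt = A(t) p\<close> on
  \<open>[s, \<infinity>)\<close> is understood in the sense of Caratheodory, that is, as an integral equation with a
  Lebesgue integral.\<close>

definition solves_forward ::
    "enat \<Rightarrow> (nat \<Rightarrow> nat \<Rightarrow> real \<Rightarrow> real) \<Rightarrow> real \<Rightarrow> (real \<Rightarrow> nat \<Rightarrow> real) \<Rightarrow> bool" where
  "solves_forward S q s p \<longleftrightarrow>
     (\<forall>i\<in>states S. \<forall>t\<ge>s.
        (\<lambda>u. \<Sum>\<^sub>\<infinity>j\<in>states S. A_mat S q u i j * p u j) absolutely_integrable_on {s..t} \<and>
        p t i = p s i + integral {s..t} (\<lambda>u. \<Sum>\<^sub>\<infinity>j\<in>states S. A_mat S q u i j * p u j))"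

definition state_probabilities ::
    "enat \<Rightarrow> (nat \<Rightarrow> nat \<Rightarrow> real \<Rightarrow> real) \<Rightarrow> real \<Rightarrow> (real \<Rightarrow> nat \<Rightarrow> real) \<Rightarrow> bool" where
  "state_probabilities S q s p \<longleftrightarrow> (\<forall>t\<ge>s. prob_vec S (p t)) \<and> solves_forward S q s p"


subsection \<open>Inhomogeneous continuous-time Markov chains\<close>

text \<open>\<open>P s t i j\<close> are the transition probabilities and \<open>Q k\<close> is the law under which the process
  \<open>X\<close> starts in \<open>k\<close>, so that conditioning on \<open>X 0 = k\<close> makes sense for every state \<open>k\<close>. In
  \<open>markov\<close> the finite set \<open>H\<close> of pairs (time, state) is the observed past. Summability in
  \<open>bounded_rates\<close> makes the bound on the diagonal meaningful, since a divergent infinite sum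
  is \<open>0\<close> by convention.\<close>

locale inhom_ctmc =
  fixes S :: enat
    and q :: "nat \<Rightarrow> nat \<Rightarrow> real \<Rightarrow> real"
    and L :: real
    and P :: "real \<Rightarrow> real \<Rightarrow> nat \<Rightarrow> nat \<Rightarrow> real"
    and Q :: "nat \<Rightarrow> 'w measure"
    and X :: "real \<Rightarrow> 'w \<Rightarrow> nat"
  assumes rates_nonneg:
      "\<And>i j t. \<lbrakk>i \<in> states S; j \<in> states S; i \<noteq> j; 0 \<le> t\<rbrakk> \<Longrightarrow> 0 \<le> q i j t"
    and rates_integrable:
      "\<And>i j T. \<lbrakk>i \<in> states S; j \<in> states S; i \<noteq> j\<rbrakk>
         \<Longrightarrow> (\<lambda>t. q i j t) absolutely_integrable_on {0..T}"
    and bounded_rates: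
      "AE t in lebesgue. 0 \<le> t \<longrightarrow>
         (\<forall>i\<in>states S. (\<lambda>j. q i j t) summable_on (states S - {i}) \<and> \<bar>A_mat S q t i i\<bar> \<le> L)"
    and transition_initial:
      "\<And>s i j. \<lbrakk>0 \<le> s; i \<in> states S; j \<in> states S\<rbrakk> \<Longrightarrow> P s s i j = (if i = j then 1 else 0)"
    and chapman_kolmogorov:
      "\<And>s u t i j. \<lbrakk>0 \<le> s; s \<le> u; u \<le> t; i \<in> states S; j \<in> states S\<rbrakk>
         \<Longrightarrow> ((\<lambda>k. P s u i k * P u t k j) has_sum P s t i j) (states S)"
    and transition_forward:
      "\<And>s i. \<lbrakk>0 \<le> s; i \<in> states S\<rbrakk> \<Longrightarrow> state_probabilities S q s (\<lambda>t. P s t i)"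
    and prob_space_Q: "\<And>k. k \<in> states S \<Longrightarrow> prob_space (Q k)"
    and measurable_X:
      "\<And>k t. \<lbrakk>k \<in> states S; 0 \<le> t\<rbrakk> \<Longrightarrow> X t \<in> measurable (Q k) (count_space (states S))"
    and start: "\<And>k. k \<in> states S \<Longrightarrow> \<P>(w in Q k. X 0 w = k) = 1"
    and markov:
      "\<And>k H s t i j.
         \<lbrakk>k \<in> states S; finite H; \<And>u x. (u, x) \<in> H \<Longrightarrow> 0 \<le> u \<and> u \<le> s;
          0 \<le> s; s \<le> t; i \<in> states S; j \<in> states S\<rbrakk> \<Longrightarrow>
         \<P>(w in Q k. (\<forall>(u, x)\<in>H. X u w = x) \<and> X s w = i \<and> X t w = j) =
         \<P>(w in Q k. (\<forall>(u, x)\<in>H. X u w = x) \<and> X s w = i) * P s t i j"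

definition mean_from :: "(nat \<Rightarrow> 'w measure) \<Rightarrow> (real \<Rightarrow> 'w \<Rightarrow> nat) \<Rightarrow> real \<Rightarrow> nat \<Rightarrow> real" where
  "mean_from Q X t k = (\<integral>w. real (X t w) \<partial>Q k)"

text \<open>Integrability is required so that the means are finite and not the default value \<open>0\<close>
  of the Bochner integral.\<close>

definition limiting_mean ::
    "enat \<Rightarrow> (nat \<Rightarrow> 'w measure) \<Rightarrow> (real \<Rightarrow> 'w \<Rightarrow> nat) \<Rightarrow> (real \<Rightarrow> real) \<Rightarrow> bool" where
  "limiting_mean S Q X \<phi> \<longleftrightarrow>
     (\<forall>k\<in>states S.
        (\<forall>t\<ge>0. integrable (Q k) (\<lambda>w. real (X t w))) \<and>
        ((\<lambda>t. \<bar>mean_from Q X t k - \<phi> t\<bar>) \<longlongrightarrow> 0) at_top)"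


subsection \<open>The norm defined by the triangular matrix \<open>D\<close>\<close>

definition mat_mul ::
    "nat set \<Rightarrow> (nat \<Rightarrow> nat \<Rightarrow> real) \<Rightarrow> (nat \<Rightarrow> nat \<Rightarrow> real) \<Rightarrow> nat \<Rightarrow> nat \<Rightarrow> real" where
  "mat_mul I M N i j = (\<Sum>\<^sub>\<infinity>k\<in>I. M i k * N k j)"

definition mat_vec :: "nat set \<Rightarrow> (nat \<Rightarrow> nat \<Rightarrow> real) \<Rightarrow> (nat \<Rightarrow> real) \<Rightarrow> nat \<Rightarrow> real" where
  "mat_vec I M x i = (\<Sum>\<^sub>\<infinity>k\<in>I. M i k * x k)"

definition norm_l1 :: "nat set \<Rightarrow> (nat \<Rightarrow> real) \<Rightarrow> ennreal" where
  "norm_l1 I x = (\<Sum>\<^sub>\<infinity>i\<in>I. ennreal \<bar>x i\<bar>)"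

definition opnorm_l1 :: "nat set \<Rightarrow> (nat \<Rightarrow> nat \<Rightarrow> real) \<Rightarrow> ennreal" where
  "opnorm_l1 I M = (SUP j\<in>I. \<Sum>\<^sub>\<infinity>i\<in>I. ennreal \<bar>M i j\<bar>)"

definition D_mat :: "(nat \<Rightarrow> real) \<Rightarrow> nat \<Rightarrow> nat \<Rightarrow> real" where
  "D_mat d i j = (if i \<le> j then d i else 0)"

definition D_inv :: "(nat \<Rightarrow> real) \<Rightarrow> nat \<Rightarrow> nat \<Rightarrow> real" where
  "D_inv d i j = (if j = i then 1 / d i else if j = Suc i then - (1 / d j) else 0)"

text \<open>The two norms below only look at indices \<open>i \<ge> 1\<close>, so that \<open>norm_1D S d p\<close> is also the
  norm of a vector \<open>p\<close> indexed from \<open>0\<close>. They are meaningful for summable vectors and for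
  matrices with summable columns.\<close>

definition norm_1D :: "enat \<Rightarrow> (nat \<Rightarrow> real) \<Rightarrow> (nat \<Rightarrow> real) \<Rightarrow> ennreal" where
  "norm_1D S d z = norm_l1 (pos_states S) (mat_vec (pos_states S) (D_mat d) z)"

definition opnorm_1D :: "enat \<Rightarrow> (nat \<Rightarrow> real) \<Rightarrow> (nat \<Rightarrow> nat \<Rightarrow> real) \<Rightarrow> ennreal" where
  "opnorm_1D S d M =
     opnorm_l1 (pos_states S)
       (mat_mul (pos_states S) (mat_mul (pos_states S) (D_mat d) M) (D_inv d))"

definition l1D :: "enat \<Rightarrow> (nat \<Rightarrow> real) \<Rightarrow> (nat \<Rightarrow> real) set" where
  "l1D S d = {z. z summable_on pos_states S \<and> norm_1D S d z < \<infinity>}"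

lemma D_inv_right:
  assumes "\<And>i. i \<in> pos_states S \<Longrightarrow> d i \<noteq> 0" "i \<in> pos_states S" "j \<in> pos_states S"
  shows "mat_mul (pos_states S) (D_mat d) (D_inv d) i j = (if i = j then 1 else 0)"
proof -
  let ?F = "{j - 1, j} \<inter> pos_states S"
  have "mat_mul (pos_states S) (D_mat d) (D_inv d) i j = (\<Sum>\<^sub>\<infinity>k\<in>?F. D_mat d i k * D_inv d k j)"
    unfolding mat_mul_def by (rule infsum_cong_neutral) (auto simp: D_inv_def)
  also have "\<dots> = (\<Sum>k\<in>?F. D_mat d i k * D_inv d k j)"
    by (rule infsum_finite) auto
  also have "\<dots> = (if i = j then 1 else 0)"
  proof (cases "j - 1 \<in> pos_states S")
    case True
    then have "?F = {j - 1, j}" "j \<noteq> j - 1" "Suc (j - 1) = j"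
      using assms by (auto simp: pos_states_def)
    then show ?thesis
      using assms by (auto simp: D_mat_def D_inv_def)
  next
    case False
    have "enat (j - 1) \<le> S"
      using assms(3) order_trans[of "enat (j - 1)" "enat j" S] by (auto simp: pos_states_def)
    with False assms(3) have "j = 1" by (auto simp: pos_states_def)
    with False assms(3) have "?F = {j}" by auto
    with \<open>j = 1\<close> assms show ?thesis
      by (auto simp: D_mat_def D_inv_def pos_states_def)
  qed
  finally show ?thesis .
qed

lemma D_inv_left:
  assumes "\<And>i. i \<in> pos_states S \<Longrightarrow> d i \<noteq> 0" "i \<in> pos_states S" "j \<in> pos_states S"
  shows "mat_mul (pos_states S) (D_inv d) (D_mat d) i j = (if i = j then 1 else 0)"
proof -
  let ?F = "{i, Suc i} \<inter> pos_states S"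
  have "mat_mul (pos_states S) (D_inv d) (D_mat d) i j = (\<Sum>\<^sub>\<infinity>k\<in>?F. D_inv d i k * D_mat d k j)"
    unfolding mat_mul_def by (rule infsum_cong_neutral) (auto simp: D_inv_def)
  also have "\<dots> = (\<Sum>k\<in>?F. D_inv d i k * D_mat d k j)"
    by (rule infsum_finite) auto
  also have "\<dots> = (if i = j then 1 else 0)"
  proof (cases "Suc i \<in> pos_states S")
    case True
    then have "?F = {i, Suc i}" using assms by auto
    then show ?thesis
      using assms(1)[OF assms(2)] assms(1)[OF True] by (auto simp: D_mat_def D_inv_def)
  next
    case False
    have "j \<le> i"
    proof (rule ccontr)
      assume "\<not> j \<le> i"
      then have "enat (Suc i) \<le> enat j" by simp
      moreover have "enat j \<le> S" using assms(3) by (simp add: pos_states_def)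
      ultimately have "enat (Suc i) \<le> S" by (rule order_trans)
      with False show False by (auto simp: pos_states_def)
    qed
    moreover have "?F = {i}" using False assms(2) by auto
    ultimately show ?thesis
      using assms(1)[OF assms(2)] by (auto simp: D_mat_def D_inv_def)
  qed
  finally show ?thesis .
qed

definition exp_weakly_ergodic_1D ::
    "enat \<Rightarrow> (nat \<Rightarrow> real) \<Rightarrow> (nat \<Rightarrow> nat \<Rightarrow> real \<Rightarrow> real) \<Rightarrow> real \<Rightarrow> real \<Rightarrow> bool" where
  "exp_weakly_ergodic_1D S d q M a \<longleftrightarrow>
     0 < M \<and> 0 < a \<and>
     (\<forall>s\<ge>0. \<forall>p p'.
        state_probabilities S q s p \<and> state_probabilities S q s p' \<and>
        p s \<in> l1D S d \<and> p' s \<in> l1D S d \<longrightarrow>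
        (\<forall>t\<ge>s. norm_1D S d (\<lambda>i. p t i - p' t i)
               \<le> ennreal (M * exp (- a * (t - s))) * norm_1D S d (\<lambda>i. p s i - p' s i)))"

end

theory Submission
  imports Defs "HOL-Real_Asymp.Real_Asymp"
begin

text \<open>
  Let \<open>V(t, s)\<close> be the evolution operator of the unperturbed forward system on vectors with sum zero.
  The proof rests on variation of constants: if a curve \<open>w\<close> of such vectors satisfies the system up to
  a defect of norm at most \<open>\<Delta> \<parallel>w\<parallel> + c\<close>, and \<open>\<parallel>V(t, s)\<parallel> \<le> M exp (- a (t - s))\<close>, then
  \<open>\<parallel>w(t)\<parallel> \<le> M exp (- (a - M \<Delta>) (t - s)) \<parallel>w(s)\<parallel> + M c / (a - M \<Delta>)\<close>.
  This is \<open>nearly_solves_decay\<close>. It is applied to three curves. For \<open>w = p - \<delta>\<^sub>0\<close> the defect is the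
  inhomogeneity \<open>f\<close>, which gives \<open>limsup \<parallel>p\<parallel> \<le> M \<ff> / a\<close> (\<open>solution_bound\<close>). For the difference of two
  solutions of the perturbed system the defect has relative size \<open>\<Delta>B\<close>, which gives ergodicity with
  constants \<open>M\<close> and \<open>a - M \<Delta>B\<close> (\<open>perturbed_difference_decay\<close>). For \<open>w = p - p'\<close> with one solution of
  each system, the defect is bounded by \<open>\<Delta>B (\<parallel>w\<parallel> + \<parallel>p\<parallel>) + \<Delta>f\<close> (\<open>solution_perturbed_solution\<close>), and
  inserting the bound for \<open>\<parallel>p\<parallel>\<close> gives the asserted limit (\<open>eventually_close\<close>).

  Coordinates are chosen so that only finite sums meet integrals over time: on vectors with sum zero
  the tails in \<open>D x\<close> are negated partial sums \<open>cum x i\<close>. Summation by parts shows that a matrix is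
  bounded in the norm \<open>\<Sum>i. d i \<bar>cum x i\<bar>\<close> as soon as the differences of its neighbouring columns are
  (\<open>wbound_mat_apply\<close>). This one lemma turns the operator norms into bounds for the generator, and the
  ergodicity of pairs of probability vectors into a bound for \<open>V\<close>.

  The rates are merely locally integrable in time, and \<open>V(t, s)\<close>, built from the transition probabilities, is
  known to satisfy only the forward equation. Variation of constants is therefore carried out by short
  time steps in a norm adapted to \<open>V\<close>, in which \<open>V(t, s)\<close> contracts by \<open>exp (- a (t - s))\<close>
  (\<open>adapted_bound_step\<close>). The steps need a local bound for the norm of every solution that starts in
  the weighted space; it comes from truncated moments, whose drift is controlled by the signs of the
  rates (\<open>moment_locally_bounded\<close>).

  Finally, a mean is a sum of tail probabilities, so \<open>W\<close> times a difference of means is at most the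
  weighted norm (\<open>tail_sum_diff_le\<close>).
\<close>

section \<open>The weighted norm in terms of partial sums\<close>

lemma zero_in_states [simp]: "0 \<in> states S"
  by (simp add: states_def flip: zero_enat_def)

lemma pos_states_eq: "pos_states S = states S - {0}"
  by (auto simp: pos_states_def states_def)

lemma states_downward: "i \<in> states S \<Longrightarrow> k \<le> i \<Longrightarrow> k \<in> states S"
  by (auto simp: states_def intro: order_trans[of "enat k" "enat i" S])

lemma pos_states_downward: "i \<in> pos_states S \<Longrightarrow> k \<le> i \<Longrightarrow> k \<in> states S"
  by (auto simp: pos_states_eq intro: states_downward)

definition cum :: "(nat \<Rightarrow> real) \<Rightarrow> nat \<Rightarrow> real" where
  "cum x i = (\<Sum>k<i. x k)"

text \<open>The meaning is that the weighted norm of \<open>x\<close> is at most \<open>K\<close>, if \<open>x\<close> has sum zero. The predicate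
  keeps all estimates real-valued: finiteness of a norm is the existence of some \<open>K\<close>, and a bound for
  almost all times is meaningful for every curve.\<close>

definition wbound :: "enat \<Rightarrow> (nat \<Rightarrow> real) \<Rightarrow> (nat \<Rightarrow> real) \<Rightarrow> real \<Rightarrow> bool" where
  "wbound S d x K \<longleftrightarrow>
     (\<forall>F. finite F \<longrightarrow> F \<subseteq> pos_states S \<longrightarrow> (\<Sum>i\<in>F. d i * \<bar>cum x i\<bar>) \<le> K)"

abbreviation null_sum :: "enat \<Rightarrow> (nat \<Rightarrow> real) \<Rightarrow> bool" where
  "null_sum S x \<equiv> (x has_sum 0) (states S)"

lemma cum_add: "cum (\<lambda>k. x k + y k) i = cum x i + cum y i"
  and cum_diff: "cum (\<lambda>k. x k - y k) i = cum x i - cum y i"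
  and cum_cmult: "cum (\<lambda>k. c * x k) i = c * cum x i"
  by (simp_all add: cum_def sum.distrib sum_subtractf sum_distrib_left)

lemma has_sum_diff_real:
  fixes f g :: "'a \<Rightarrow> real"
  assumes "(f has_sum a) A" "(g has_sum b) A"
  shows "((\<lambda>x. f x - g x) has_sum (a - b)) A"
  using has_sum_add[OF assms(1) has_sum_uminusI[OF assms(2)]] by simp

lemma summable_on_real_abs:
  fixes f :: "'a \<Rightarrow> real"
  shows "f summable_on A \<Longrightarrow> (\<lambda>x. \<bar>f x\<bar>) summable_on A"
  using iffD1[OF summable_on_iff_abs_summable_on_real[of f A]] by simp

lemma summable_on_bounded_mult:
  fixes f :: "'a \<Rightarrow> real"
  assumes "f summable_on A" and "\<And>x. x \<in> A \<Longrightarrow> \<bar>m x\<bar> \<le> L"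
  shows "(\<lambda>x. m x * f x) summable_on A"
proof -
  have "(\<lambda>x. norm (m x * f x)) summable_on A"
    by (rule Infinite_Sum.abs_summable_on_comparison_test'[where g = "\<lambda>x. L * \<bar>f x\<bar>"])
      (use assms summable_on_real_abs in \<open>auto simp: abs_mult intro!: mult_right_mono summable_on_cmult_right\<close>)
  then show ?thesis by (rule abs_summable_summable)
qed

lemma has_sum_finite_sum:
  fixes f :: "'b \<Rightarrow> 'a \<Rightarrow> real"
  assumes "finite I" and "\<And>i. i \<in> I \<Longrightarrow> (f i has_sum s i) A"
  shows "((\<lambda>x. \<Sum>i\<in>I. f i x) has_sum (\<Sum>i\<in>I. s i)) A"
  using assms by (induction I rule: finite_induct) (auto intro!: has_sum_add)

lemma cum_cong:
  assumes "\<And>k. k \<in> states S \<Longrightarrow> x k = y k" and "i \<in> pos_states S"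
  shows "cum x i = cum y i"
  unfolding cum_def using assms pos_states_downward by (auto intro!: sum.cong)

lemma wboundD: "wbound S d x K \<Longrightarrow> finite F \<Longrightarrow> F \<subseteq> pos_states S \<Longrightarrow> (\<Sum>i\<in>F. d i * \<bar>cum x i\<bar>) \<le> K"
  by (simp add: wbound_def)

lemma wbound_nonneg: "wbound S d x K \<Longrightarrow> 0 \<le> K"
  using wboundD[of S d x K "{}"] by simp

lemma wbound_mono: "wbound S d x K \<Longrightarrow> K \<le> K' \<Longrightarrow> wbound S d x K'"
  unfolding wbound_def by (meson order_trans)

lemma wbound_cong:
  assumes "\<And>k. k \<in> states S \<Longrightarrow> x k = y k"
  shows "wbound S d x K \<longleftrightarrow> wbound S d y K"
  unfolding wbound_def using cum_cong[of S x y, OF assms]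
  by (smt (verit, ccfv_SIG) subsetD sum.cong)

lemma wbound_cmult:
  assumes "wbound S d x K" shows "wbound S d (\<lambda>k. c * x k) (\<bar>c\<bar> * K)"
  unfolding wbound_def
proof (intro allI impI)
  fix F assume F: "finite F" "F \<subseteq> pos_states S"
  have "(\<Sum>i\<in>F. d i * \<bar>cum (\<lambda>k. c * x k) i\<bar>) = \<bar>c\<bar> * (\<Sum>i\<in>F. d i * \<bar>cum x i\<bar>)"
    by (simp add: cum_cmult abs_mult sum_distrib_left mult_ac)
  also have "\<dots> \<le> \<bar>c\<bar> * K"
    using wboundD[OF assms F] by (simp add: mult_left_mono)
  finally show "(\<Sum>i\<in>F. d i * \<bar>cum (\<lambda>k. c * x k) i\<bar>) \<le> \<bar>c\<bar> * K" .
qed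

locale tail_weights =
  fixes S :: enat and d :: "nat \<Rightarrow> real"
  assumes weight_ge_1: "i \<in> pos_states S \<Longrightarrow> 1 \<le> d i"
begin

lemma weight_nonneg: "i \<in> pos_states S \<Longrightarrow> 0 \<le> d i"
  using weight_ge_1[of i] by linarith

lemma wbound_add:
  assumes "wbound S d x K" "wbound S d y K'"
  shows "wbound S d (\<lambda>k. x k + y k) (K + K')"
  unfolding wbound_def
proof (intro allI impI)
  fix F assume F: "finite F" "F \<subseteq> pos_states S"
  have "(\<Sum>i\<in>F. d i * \<bar>cum (\<lambda>k. x k + y k) i\<bar>)
      \<le> (\<Sum>i\<in>F. d i * \<bar>cum x i\<bar> + d i * \<bar>cum y i\<bar>)"
    using F weight_nonneg
    by (intro sum_mono) (auto simp: cum_add simp flip: distrib_left intro!: mult_left_mono)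
  also have "\<dots> \<le> K + K'"
    using wboundD[OF assms(1) F] wboundD[OF assms(2) F] by (simp add: sum.distrib)
  finally show "(\<Sum>i\<in>F. d i * \<bar>cum (\<lambda>k. x k + y k) i\<bar>) \<le> K + K'" .
qed

lemma wbound_minus:
  "wbound S d x K \<Longrightarrow> wbound S d (\<lambda>k. - x k) K"
  using wbound_cmult[of S d x K "-1"] by simp

lemma wbound_diff:
  assumes "wbound S d x K" "wbound S d y K'"
  shows "wbound S d (\<lambda>k. x k - y k) (K + K')"
  using wbound_add[OF assms(1) wbound_minus[OF assms(2)]] by simp

text \<open>Because the coordinates sum to zero, the tail \<open>\<Sum>k\<ge>i. x k\<close> that \<open>D\<close> produces is minus a finite
  partial sum. All exchanges of sums with integrals over time thereby become finite.\<close>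

lemma mat_vec_D_mat:
  assumes x: "null_sum S x" and i: "i \<in> pos_states S"
  shows "((\<lambda>k. D_mat d i k * x k) has_sum - (d i * cum x i)) (pos_states S)"
proof -
  let ?T = "states S - {..<i}"
  have sub: "{..<i} \<subseteq> states S"
    using pos_states_downward[OF i] by auto
  have "(x has_sum (0 - cum x i)) ?T"
    by (rule has_sum_Diff[OF x]) (auto simp: cum_def sub)
  then have "((\<lambda>k. d i * x k) has_sum d i * (0 - cum x i)) ?T"
    by (rule has_sum_cmult_right)
  also have "?this \<longleftrightarrow> ?thesis"
    unfolding minus_mult_right diff_0 using i
    by (intro has_sum_cong_neutral) (auto simp: D_mat_def pos_states_eq)
  finally show ?thesis .
qed

lemma norm_1D_eq:
  assumes x: "null_sum S x"
  shows "norm_1D S d x = (\<Sum>\<^sub>\<infinity>i\<in>pos_states S. ennreal (d i * \<bar>cum x i\<bar>))"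
  unfolding norm_1D_def norm_l1_def mat_vec_def
  using weight_nonneg by (intro infsum_cong) (simp add: infsumI[OF mat_vec_D_mat[OF x]] abs_mult)

lemma norm_1D_le_iff:
  assumes x: "null_sum S x" and K: "0 \<le> K"
  shows "norm_1D S d x \<le> ennreal K \<longleftrightarrow> wbound S d x K"
proof -
  have "norm_1D S d x = (SUP F\<in>{F. finite F \<and> F \<subseteq> pos_states S}. \<Sum>i\<in>F. ennreal (d i * \<bar>cum x i\<bar>))"
    unfolding norm_1D_eq[OF x] by (rule nonneg_infsum_complete) simp
  also have "\<dots> = (SUP F\<in>{F. finite F \<and> F \<subseteq> pos_states S}. ennreal (\<Sum>i\<in>F. d i * \<bar>cum x i\<bar>))"
    using weight_nonneg by (intro SUP_cong refl sum_ennreal) auto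
  finally show ?thesis
    using K by (auto simp: SUP_le_iff wbound_def ennreal_le_iff)
qed

lemma norm_1D_finite_iff:
  assumes x: "null_sum S x"
  shows "norm_1D S d x < \<infinity> \<longleftrightarrow> (\<exists>K. wbound S d x K)"
proof
  assume "norm_1D S d x < \<infinity>"
  then have "norm_1D S d x \<le> ennreal (enn2real (norm_1D S d x))" by simp
  then show "\<exists>K. wbound S d x K" using norm_1D_le_iff[OF x] enn2real_nonneg by blast
next
  assume "\<exists>K. wbound S d x K"
  then obtain K where "wbound S d x K" ..
  then have "norm_1D S d x \<le> ennreal K"
    using norm_1D_le_iff[OF x] wbound_nonneg by blast
  then show "norm_1D S d x < \<infinity>" by (simp add: le_less_trans)
qed

section \<open>Matrices with bounded column differences\<close>

lemma null_sum_cum_tendsto: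
  assumes x: "null_sum S x"
  defines "e \<equiv> \<lambda>j. if j \<in> states S then x j else 0"
  shows "cum e \<longlonglongrightarrow> 0" and "j \<notin> states S \<Longrightarrow> cum e j = 0"
proof -
  have "(e has_sum 0) UNIV \<longleftrightarrow> null_sum S x"
    by (rule has_sum_cong_neutral) (auto simp: e_def)
  with x have e: "(e has_sum 0) UNIV" by blast
  then show "cum e \<longlonglongrightarrow> 0"
    using has_sum_imp_sums[OF e] by (simp add: sums_def cum_def[abs_def])
  assume j: "j \<notin> states S"
  have "(e has_sum (\<Sum>k<j. e k)) UNIV"
    using j states_downward[of _ S j]
    by (intro has_sum_finite_neutralI[of "{..<j}"]) (auto simp: e_def not_less)
  with e show "cum e j = 0"
    by (metis cum_def has_sum_unique)
qed

lemma summation_by_parts: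
  fixes \<alpha> e :: "nat \<Rightarrow> real"
  shows "(\<Sum>j<Suc n. \<alpha> j * e j)
    = \<alpha> n * cum e (Suc n) - (\<Sum>j=1..n. (\<alpha> j - \<alpha> (j - 1)) * cum e j)"
proof (induction n)
  case (Suc n)
  have "(\<Sum>j<Suc (Suc n). \<alpha> j * e j)
      = \<alpha> n * cum e (Suc n) - (\<Sum>j=1..n. (\<alpha> j - \<alpha> (j - 1)) * cum e j) + \<alpha> (Suc n) * e (Suc n)"
    using Suc.IH by simp
  moreover have "cum e (Suc (Suc n)) = cum e (Suc n) + e (Suc n)"
    by (simp add: cum_def)
  ultimately show ?case
    by (simp add: algebra_simps)
qed (simp add: cum_def)

text \<open>Summation by parts expands a vector with sum zero in the basis \<open>\<delta>\<^sub>j - \<delta>\<^bsub>j-1\<^esub>\<close>, whose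
  coefficients are its tails and whose members have norm \<open>d j\<close>. A matrix is thus bounded in the
  weighted norm as soon as it is bounded on this basis, that is, as soon as the differences of
  neighbouring columns are.\<close>

lemma wbound_mat_apply:
  assumes m: "\<And>k j. k \<in> states S \<Longrightarrow> j \<in> states S \<Longrightarrow> \<bar>m k j\<bar> \<le> L"
    and cols: "\<And>j. j \<in> pos_states S \<Longrightarrow> wbound S d (\<lambda>k. m k j - m k (j - 1)) (K * d j)"
    and x: "null_sum S x" and R: "wbound S d x R" and K: "0 \<le> K"
  shows "wbound S d (\<lambda>k. \<Sum>\<^sub>\<infinity>j\<in>states S. m k j * x j) (K * R)"
  unfolding wbound_def
proof (intro allI impI)
  fix F assume F: "finite F" "F \<subseteq> pos_states S"
  define e where "e \<equiv> \<lambda>j. if j \<in> states S then x j else 0"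
  define \<alpha> where "\<alpha> \<equiv> \<lambda>i j. \<Sum>k<i. m k j"
  define y where "y \<equiv> \<lambda>k. \<Sum>\<^sub>\<infinity>j\<in>states S. m k j * x j"
  define r where "r \<equiv> \<lambda>n i. \<Sum>j=1..n. (\<alpha> i j - \<alpha> i (j - 1)) * cum e j"
  note e0 = null_sum_cum_tendsto[OF x, folded e_def]
  have L: "0 \<le> L" using m[of 0 0] by (meson abs_ge_zero order_trans zero_in_states)
  have mx: "(\<lambda>j. m k j * x j) summable_on states S" if "k \<in> states S" for k
    using has_sum_imp_summable[OF x] m[OF that] by (rule summable_on_bounded_mult)
  have lim: "(\<lambda>n. r n i) \<longlonglongrightarrow> - cum y i" if i: "i \<in> pos_states S" for i
  proof -
    have "((\<lambda>j. \<Sum>k<i. m k j * x j) has_sum cum y i) (states S)"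
      unfolding cum_def y_def
      using pos_states_downward[OF i] mx by (intro has_sum_finite_sum) (auto simp: summable_iff_has_sum_infsum)
    also have "?this \<longleftrightarrow> ((\<lambda>j. \<alpha> i j * e j) has_sum cum y i) UNIV"
      by (intro has_sum_cong_neutral) (auto simp: \<alpha>_def e_def sum_distrib_right)
    finally have "(\<lambda>n. \<Sum>j<n. \<alpha> i j * e j) \<longlonglongrightarrow> cum y i"
      by (auto dest: has_sum_imp_sums simp: sums_def)
    then have s1: "(\<lambda>n. \<Sum>j<Suc n. \<alpha> i j * e j) \<longlonglongrightarrow> cum y i"
      by (rule LIMSEQ_Suc)
    have s2: "(\<lambda>n. \<alpha> i n * cum e (Suc n)) \<longlonglongrightarrow> 0"
    proof (rule Lim_null_comparison)
      show "\<forall>\<^sub>F n in sequentially. norm (\<alpha> i n * cum e (Suc n)) \<le> (real i * L) * \<bar>cum e (Suc n)\<bar>"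
      proof (rule always_eventually, rule allI)
        fix n
        show "norm (\<alpha> i n * cum e (Suc n)) \<le> (real i * L) * \<bar>cum e (Suc n)\<bar>"
        proof (cases "n \<in> states S")
          case True
          have "\<bar>\<alpha> i n\<bar> \<le> (\<Sum>k<i. L)"
            unfolding \<alpha>_def using m[OF pos_states_downward[OF i] True]
            by (intro order_trans[OF sum_abs] sum_mono) auto
          then show ?thesis by (auto simp: abs_mult intro!: mult_right_mono)
        next
          case False
          then have "Suc n \<notin> states S" using states_downward[of "Suc n" S n] by auto
          then show ?thesis by (simp add: e0(2))
        qed
      qed
      show "(\<lambda>n. (real i * L) * \<bar>cum e (Suc n)\<bar>) \<longlonglongrightarrow> 0"
        using tendsto_mult_right_zero[OF tendsto_rabs_zero[OF LIMSEQ_Suc[OF e0(1)]]] .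
    qed
    have "r n i = \<alpha> i n * cum e (Suc n) - (\<Sum>j<Suc n. \<alpha> i j * e j)" for n
      unfolding r_def summation_by_parts by simp
    then show ?thesis
      using tendsto_diff[OF s2 s1] by (simp add: fun_eq_iff)
  qed
  have bound: "(\<Sum>i\<in>F. d i * \<bar>r n i\<bar>) \<le> K * R" for n
  proof -
    have "(\<Sum>i\<in>F. d i * \<bar>r n i\<bar>)
        \<le> (\<Sum>i\<in>F. d i * (\<Sum>j=1..n. \<bar>\<alpha> i j - \<alpha> i (j - 1)\<bar> * \<bar>cum e j\<bar>))"
      using F weight_nonneg unfolding r_def
      by (intro sum_mono mult_left_mono order_trans[OF sum_abs]) (auto simp: abs_mult)
    also have "\<dots> = (\<Sum>j=1..n. \<bar>cum e j\<bar> * (\<Sum>i\<in>F. d i * \<bar>\<alpha> i j - \<alpha> i (j - 1)\<bar>))"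
      unfolding sum_distrib_left by (subst sum.swap) (simp add: mult_ac)
    also have "\<dots> = (\<Sum>j\<in>{1..n} \<inter> pos_states S. \<bar>cum e j\<bar> * (\<Sum>i\<in>F. d i * \<bar>\<alpha> i j - \<alpha> i (j - 1)\<bar>))"
      using e0(2) by (intro sum.mono_neutral_right) (auto simp: pos_states_eq)
    also have "\<dots> \<le> (\<Sum>j\<in>{1..n} \<inter> pos_states S. \<bar>cum e j\<bar> * (K * d j))"
    proof (intro sum_mono mult_left_mono)
      fix j assume "j \<in> {1..n} \<inter> pos_states S"
      then show "(\<Sum>i\<in>F. d i * \<bar>\<alpha> i j - \<alpha> i (j - 1)\<bar>) \<le> K * d j"
        using wboundD[OF cols F, of j] by (simp add: cum_def \<alpha>_def sum_subtractf)
    qed auto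
    also have "\<dots> = K * (\<Sum>j\<in>{1..n} \<inter> pos_states S. d j * \<bar>cum x j\<bar>)"
    proof -
      have "cum e j = cum x j" if "j \<in> pos_states S" for j
        by (rule cum_cong[OF _ that]) (simp add: e_def)
      then show ?thesis
        by (simp add: sum_distrib_left mult_ac)
    qed
    also have "\<dots> \<le> K * R"
      using K by (intro mult_left_mono wboundD[OF R]) auto
    finally show ?thesis .
  qed
  have "(\<lambda>n. \<Sum>i\<in>F. d i * \<bar>r n i\<bar>) \<longlonglongrightarrow> (\<Sum>i\<in>F. d i * \<bar>- cum y i\<bar>)"
    using F lim by (intro tendsto_sum tendsto_mult tendsto_const tendsto_rabs) auto
  then have "(\<Sum>i\<in>F. d i * \<bar>- cum y i\<bar>) \<le> K * R"
    by (rule LIMSEQ_le_const2) (use bound in auto)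
  then show "(\<Sum>i\<in>F. d i * \<bar>cum (\<lambda>k. \<Sum>\<^sub>\<infinity>j\<in>states S. m k j * x j) i\<bar>) \<le> K * R"
    by (simp add: y_def)
qed

text \<open>Column \<open>j\<close> of \<open>D B D\<^sup>-\<^sup>1\<close> is, up to the factor \<open>1 / d j\<close>, the vector of weighted tails of the
  difference of columns \<open>j\<close> and \<open>j - 1\<close> of the generator. The subtraction of column \<open>0\<close> that turns
  a generator into its reduced matrix cancels, except in column \<open>1\<close>, where it supplies column \<open>0\<close>.\<close>

lemma opnorm_1D_column:
  assumes cols: "\<And>j. j \<in> states S \<Longrightarrow> null_sum S (\<lambda>k. m k j)"
    and op: "opnorm_1D S d (\<lambda>i j. m i j - m i 0) \<le> ennreal K" and K: "0 \<le> K"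
    and j: "j \<in> pos_states S"
  shows "wbound S d (\<lambda>k. m k j - m k (j - 1)) (K * d j)"
  unfolding wbound_def
proof (intro allI impI)
  fix F assume F: "finite F" "F \<subseteq> pos_states S"
  let ?I = "pos_states S"
  define DB where "DB \<equiv> mat_mul ?I (D_mat d) (\<lambda>i j. m i j - m i 0)"
  have DB: "DB i l = - (d i * cum (\<lambda>k. m k l - m k 0) i)" if "i \<in> ?I" "l \<in> states S" for i l
  proof -
    have "null_sum S (\<lambda>k. m k l - m k 0)"
      using has_sum_diff_real[OF cols[OF that(2)] cols[of 0]] by simp
    from mat_vec_D_mat[OF this that(1)] show ?thesis
      unfolding DB_def mat_mul_def by (rule infsumI)
  qed
  have dj: "d j \<noteq> 0" "0 \<le> d j" using weight_ge_1[OF j] by auto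
  have j': "j \<in> states S" "j - 1 \<in> states S" "j \<ge> 1"
    using j states_downward[of j S "j - 1"] by (auto simp: pos_states_eq)
  have entry: "mat_mul ?I DB (D_inv d) i j = - (d i * cum (\<lambda>k. m k j - m k (j - 1)) i) / d j"
    if i: "i \<in> ?I" for i
  proof -
    have "mat_mul ?I DB (D_inv d) i j = (\<Sum>\<^sub>\<infinity>k\<in>{j - 1, j} \<inter> ?I. DB i k * D_inv d k j)"
      unfolding mat_mul_def by (rule infsum_cong_neutral) (auto simp: D_inv_def)
    also have "\<dots> = (\<Sum>k\<in>{j - 1, j} \<inter> ?I. DB i k * D_inv d k j)"
      by (rule infsum_finite) auto
    also have "\<dots> = (DB i j - DB i (j - 1)) / d j"
    proof (cases "j = 1")
      case True
      have "DB i 0 = 0" using DB[OF i, of 0] by (simp add: cum_def)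
      moreover have "{j - 1, j} \<inter> ?I = {1}" using True j by (auto simp: pos_states_eq)
      ultimately show ?thesis using True by (simp add: D_inv_def)
    next
      case False
      then have "{j - 1, j} \<inter> ?I = {j - 1, j}" "j - 1 \<noteq> j" "Suc (j - 1) = j"
        using j j' by (auto simp: pos_states_eq)
      then show ?thesis using False by (simp add: D_inv_def diff_divide_distrib)
    qed
    also have "DB i j - DB i (j - 1) = - (d i * cum (\<lambda>k. m k j - m k (j - 1)) i)"
      using DB[OF i j'(1)] DB[OF i j'(2)] by (simp add: cum_diff algebra_simps)
    finally show ?thesis .
  qed
  have "(\<Sum>i\<in>F. ennreal \<bar>mat_mul ?I DB (D_inv d) i j\<bar>)
      \<le> (\<Sum>\<^sub>\<infinity>i\<in>?I. ennreal \<bar>mat_mul ?I DB (D_inv d) i j\<bar>)"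
    using F by (subst nonneg_infsum_complete) (auto intro!: SUP_upper2[of F])
  also have "\<dots> \<le> opnorm_1D S d (\<lambda>i j. m i j - m i 0)"
    unfolding opnorm_1D_def opnorm_l1_def DB_def using j by (intro SUP_upper2[of j]) auto
  also note op
  finally have "(\<Sum>i\<in>F. \<bar>mat_mul ?I DB (D_inv d) i j\<bar>) \<le> K"
    using K by (simp add: sum_ennreal ennreal_le_iff)
  moreover have "(\<Sum>i\<in>F. \<bar>mat_mul ?I DB (D_inv d) i j\<bar>)
      = (\<Sum>i\<in>F. d i * \<bar>cum (\<lambda>k. m k j - m k (j - 1)) i\<bar>) / d j"
    unfolding sum_divide_distrib
    using F weight_nonneg dj by (intro sum.cong refl) (auto simp: entry abs_mult)
  ultimately show "(\<Sum>i\<in>F. d i * \<bar>cum (\<lambda>k. m k j - m k (j - 1)) i\<bar>) \<le> K * d j"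
    using dj by (simp add: divide_le_eq)
qed

end

section \<open>Curves with a bounded derivative\<close>

lemma AE_lebesgue_obtain_negligible:
  assumes "AE u in lebesgue. P u"
  obtains N :: "real set" where "negligible N" and "\<And>u. u \<notin> N \<Longrightarrow> P u"
proof -
  from AE_E3[OF assms] obtain N where "\<And>u. u \<in> space lebesgue - N \<Longrightarrow> P u" "N \<in> null_sets lebesgue"
    by blast
  then show thesis
    by (intro that[of N]) (auto simp: negligible_iff_null_sets)
qed

lemma integral_le_const_AE:
  fixes f :: "real \<Rightarrow> real"
  assumes f: "f integrable_on {s..t}" and "s \<le> t"
    and le: "AE u in lebesgue. u \<in> {s..t} \<longrightarrow> f u \<le> K"
  shows "integral {s..t} f \<le> K * (t - s)"
proof -
  obtain N where N: "negligible N" "\<And>u. u \<notin> N \<Longrightarrow> u \<in> {s..t} \<longrightarrow> f u \<le> K"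
    using AE_lebesgue_obtain_negligible[OF le] by blast
  let ?f = "\<lambda>u. if u \<in> N then K else f u"
  have "integral {s..t} f = integral {s..t} ?f"
    by (rule integral_spike[OF N(1)]) auto
  also have "\<dots> \<le> integral {s..t} (\<lambda>u. K)"
    using N(2) integrable_spike[OF f N(1), of ?f] by (intro integral_le) auto
  also have "\<dots> = K * (t - s)" using \<open>s \<le> t\<close> by simp
  finally show ?thesis .
qed

context tail_weights
begin

text \<open>Weighting finitely many coordinates of the integral with their signs turns the norm into a scalar
  integral, whose integrand obeys the pointwise bound.\<close>

lemma wbound_evolution:
  assumes st: "s \<le> t"
    and int: "\<And>k. k \<in> states S \<Longrightarrow> (\<lambda>u. v u k) integrable_on {s..t}"
    and x: "\<And>k. k \<in> states S \<Longrightarrow> x t k = x s k + integral {s..t} (\<lambda>u. v u k)"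
    and v: "AE u in lebesgue. u \<in> {s..t} \<longrightarrow> wbound S d (v u) K"
    and R: "wbound S d (x s) R"
  shows "wbound S d (x t) (R + K * (t - s))"
  unfolding wbound_def
proof (intro allI impI)
  fix F assume F: "finite F" "F \<subseteq> pos_states S"
  let ?I = "\<lambda>i. integral {s..t} (\<lambda>u. cum (v u) i)"
  have ci: "(\<lambda>u. cum (v u) i) integrable_on {s..t}" if "i \<in> F" for i
    unfolding cum_def using that F pos_states_downward[of i S] int by (intro integrable_sum) auto
  have cx: "cum (x t) i = cum (x s) i + ?I i" if "i \<in> F" for i
  proof -
    have "?I i = (\<Sum>k<i. integral {s..t} (\<lambda>u. v u k))"
      unfolding cum_def using that F pos_states_downward[of i S] int by (intro integral_sum) auto
    moreover have "cum (x t) i = cum (\<lambda>k. x s k + integral {s..t} (\<lambda>u. v u k)) i"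
      using that F by (intro cum_cong[where S = S] x) auto
    ultimately show ?thesis by (simp add: cum_def sum.distrib)
  qed
  have "(\<Sum>i\<in>F. d i * \<bar>?I i\<bar>) = (\<Sum>i\<in>F. d i * sgn (?I i) * ?I i)"
    by (intro sum.cong refl) (simp add: abs_sgn mult_ac)
  also have "\<dots> = integral {s..t} (\<lambda>u. \<Sum>i\<in>F. d i * sgn (?I i) * cum (v u) i)"
    using F by (subst integral_sum) (auto intro!: integrable_on_mult_right ci)
  also have "\<dots> \<le> K * (t - s)"
  proof (rule integral_le_const_AE[OF _ st])
    show "(\<lambda>u. \<Sum>i\<in>F. d i * sgn (?I i) * cum (v u) i) integrable_on {s..t}"
      using F by (intro integrable_sum integrable_on_mult_right ci) auto
    have "(\<Sum>i\<in>F. d i * sgn (?I i) * cum (v u) i) \<le> K" if "wbound S d (v u) K" for u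
    proof -
      have "(\<Sum>i\<in>F. d i * sgn (?I i) * cum (v u) i) \<le> (\<Sum>i\<in>F. d i * \<bar>cum (v u) i\<bar>)"
      proof (rule sum_mono)
        fix i assume "i \<in> F"
        then have "0 \<le> d i" using F weight_nonneg by auto
        moreover have "sgn (?I i) * cum (v u) i \<le> \<bar>cum (v u) i\<bar>"
          by (auto simp: sgn_if)
        ultimately show "d i * sgn (?I i) * cum (v u) i \<le> d i * \<bar>cum (v u) i\<bar>"
          unfolding mult.assoc by (rule mult_left_mono[rotated])
      qed
      also have "\<dots> \<le> K" by (rule wboundD[OF that F])
      finally show ?thesis .
    qed
    then show "AE u in lebesgue. u \<in> {s..t} \<longrightarrow> (\<Sum>i\<in>F. d i * sgn (?I i) * cum (v u) i) \<le> K"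
      using v by (auto elim: eventually_mono)
  qed
  finally have I: "(\<Sum>i\<in>F. d i * \<bar>?I i\<bar>) \<le> K * (t - s)" .
  have "(\<Sum>i\<in>F. d i * \<bar>cum (x t) i\<bar>) \<le> (\<Sum>i\<in>F. d i * \<bar>cum (x s) i\<bar> + d i * \<bar>?I i\<bar>)"
    using F weight_nonneg
    by (intro sum_mono) (auto simp: cx simp flip: distrib_left intro!: mult_left_mono)
  also have "\<dots> \<le> R + K * (t - s)"
    using I wboundD[OF R F] by (simp add: sum.distrib)
  finally show "(\<Sum>i\<in>F. d i * \<bar>cum (x t) i\<bar>) \<le> R + K * (t - s)" .
qed

end

section \<open>Generators bounded in the weighted norm\<close>

definition regular_rates :: "enat \<Rightarrow> (nat \<Rightarrow> nat \<Rightarrow> real \<Rightarrow> real) \<Rightarrow> real \<Rightarrow> real \<Rightarrow> bool" where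
  "regular_rates S q L u \<longleftrightarrow>
     (\<forall>i\<in>states S. \<forall>j\<in>states S. i \<noteq> j \<longrightarrow> 0 \<le> q i j u) \<and>
     (\<forall>i\<in>states S. (\<lambda>j. q i j u) summable_on (states S - {i}) \<and> \<bar>A_mat S q u i i\<bar> \<le> L)"

lemma (in inhom_ctmc) AE_regular_rates: "AE u in lebesgue. 0 \<le> u \<longrightarrow> regular_rates S q L u"
  using bounded_rates rates_nonneg unfolding regular_rates_def by (auto elim!: eventually_mono)

lemma A_mat_null_sum:
  assumes reg: "regular_rates S q L u" and j: "j \<in> states S"
  shows "null_sum S (\<lambda>k. A_mat S q u k j)"
proof -
  let ?a = "\<lambda>k. A_mat S q u k j"
  have "(\<lambda>k. q j k u) summable_on (states S - {j})"
    using reg j by (auto simp: regular_rates_def)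
  then have "(?a has_sum - ?a j) (states S - {j})"
    using summable_iff_has_sum_infsum
    by (subst has_sum_cong[of _ _ "\<lambda>k. q j k u"]) (auto simp: A_mat_def)
  then have "(?a has_sum (?a j + - ?a j)) (insert j (states S - {j}))"
    by (rule has_sum_insert[rotated]) auto
  then show ?thesis using j by (simp add: insert_absorb)
qed

lemma A_mat_nonneg:
  "regular_rates S q L u \<Longrightarrow> k \<in> states S \<Longrightarrow> j \<in> states S \<Longrightarrow> k \<noteq> j \<Longrightarrow> 0 \<le> A_mat S q u k j"
  by (auto simp: regular_rates_def A_mat_def)

lemma A_mat_bounded:
  assumes reg: "regular_rates S q L u" and k: "k \<in> states S" and j: "j \<in> states S"
  shows "\<bar>A_mat S q u k j\<bar> \<le> L"
proof (cases "k = j")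
  case False
  have "\<bar>A_mat S q u j j\<bar> \<le> L" using reg j by (auto simp: regular_rates_def)
  moreover have "A_mat S q u k j + A_mat S q u j j \<le> 0"
  proof -
    have "((\<lambda>k. A_mat S q u k j) has_sum (\<Sum>k\<in>{k, j}. A_mat S q u k j)) {k, j}"
      by (rule has_sum_finite) simp
    from has_sum_mono'[OF this A_mat_null_sum[OF reg j]] show ?thesis
      using k j False A_mat_nonneg[OF reg] by auto
  qed
  ultimately show ?thesis using A_mat_nonneg[OF reg k j False] by linarith
qed (use reg j in \<open>auto simp: regular_rates_def\<close>)

text \<open>Subtracting this unit vector turns a probability vector into a vector with sum zero and leaves
  all coordinates that the weighted norm sees unchanged.\<close>

definition origin :: "nat \<Rightarrow> real" where
  "origin k = (if k = 0 then 1 else 0)"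

lemma origin_has_sum: "(origin has_sum 1) (states S)"
  by (rule has_sum_finite_neutralI[of "{0}"]) (auto simp: origin_def)

lemma cum_origin: "0 < i \<Longrightarrow> cum origin i = 1"
  by (simp add: cum_def origin_def)

lemma prob_minus_origin: "prob_vec S p \<Longrightarrow> null_sum S (\<lambda>k. p k - origin k)"
  using has_sum_diff_real[of p "states S" 1 origin 1] origin_has_sum by (simp add: prob_vec_def)

lemma prob_diff: "prob_vec S p \<Longrightarrow> prob_vec S p' \<Longrightarrow> null_sum S (\<lambda>k. p k - p' k)"
  using has_sum_diff_real[of p "states S" 1 p' 1] by (simp add: prob_vec_def)

lemma prob_tail:
  assumes p: "prob_vec S p" and i: "i \<in> pos_states S"
  shows "((\<lambda>j. (if i \<le> j then 1 else 0) * p j) has_sum (1 - cum p i)) (states S)"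
    and "cum p i \<le> 1"
proof -
  have "(p has_sum (1 - cum p i)) (states S - {..<i})"
    using p pos_states_downward[OF i]
    by (intro has_sum_Diff) (auto simp: prob_vec_def cum_def)
  also have "?this \<longleftrightarrow> ((\<lambda>j. (if i \<le> j then 1 else 0) * p j) has_sum (1 - cum p i)) (states S)"
    by (intro has_sum_cong_neutral) auto
  finally show *: "((\<lambda>j. (if i \<le> j then 1 else 0) * p j) has_sum (1 - cum p i)) (states S)" .
  have "0 \<le> 1 - cum p i"
    using p by (intro has_sum_nonneg[OF *]) (auto simp: prob_vec_def)
  then show "cum p i \<le> 1" by simp
qed

lemma generator_apply_origin:
  assumes reg: "regular_rates S q L u" and k: "k \<in> states S" and p: "prob_vec S p"
  shows "(\<Sum>\<^sub>\<infinity>j\<in>states S. A_mat S q u k j * p j)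
    = (\<Sum>\<^sub>\<infinity>j\<in>states S. A_mat S q u k j * (p j - origin j)) + A_mat S q u k 0"
proof -
  have "(\<lambda>j. A_mat S q u k j * (p j - origin j)) summable_on states S"
    using has_sum_imp_summable[OF prob_minus_origin[OF p]] A_mat_bounded[OF reg k]
    by (rule summable_on_bounded_mult)
  moreover have "((\<lambda>j. A_mat S q u k j * origin j) has_sum A_mat S q u k 0) (states S)"
    by (rule has_sum_finite_neutralI[of "{0}"]) (auto simp: origin_def)
  ultimately have "((\<lambda>j. A_mat S q u k j * (p j - origin j) + A_mat S q u k j * origin j)
      has_sum (\<Sum>\<^sub>\<infinity>j\<in>states S. A_mat S q u k j * (p j - origin j)) + A_mat S q u k 0) (states S)"
    by (intro has_sum_add has_sum_infsum)
  also have "(\<lambda>j. A_mat S q u k j * (p j - origin j) + A_mat S q u k j * origin j)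
      = (\<lambda>j. A_mat S q u k j * p j)"
    by (simp add: fun_eq_iff right_diff_distrib)
  finally show ?thesis by (rule infsumI)
qed

text \<open>By \<open>opnorm_1D_column\<close> the first condition bounds the reduced matrix by \<open>B\<close> in the operator norm;
  the second one bounds the inhomogeneity by \<open>F\<close>.\<close>

definition bounded_generator ::
    "enat \<Rightarrow> (nat \<Rightarrow> real) \<Rightarrow> (nat \<Rightarrow> nat \<Rightarrow> real) \<Rightarrow> real \<Rightarrow> real \<Rightarrow> bool" where
  "bounded_generator S d m B F \<longleftrightarrow>
     (\<forall>j\<in>pos_states S. wbound S d (\<lambda>k. m k j - m k (j - 1)) (B * d j)) \<and> wbound S d (\<lambda>k. m k 0) F"

lemma state_probabilities_integral:
  assumes "state_probabilities S q s p" and "k \<in> states S" and "s \<le> t"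
  shows "(\<lambda>u. \<Sum>\<^sub>\<infinity>j\<in>states S. A_mat S q u k j * p u j) integrable_on {s..t}"
    and "p t k = p s k + integral {s..t} (\<lambda>u. \<Sum>\<^sub>\<infinity>j\<in>states S. A_mat S q u k j * p u j)"
  using assms unfolding state_probabilities_def solves_forward_def absolutely_integrable_on_def
  by blast+

lemma solves_forward_restart:
  assumes p: "solves_forward S q s p" and "s \<le> u"
  shows "solves_forward S q u p"
  unfolding solves_forward_def
proof (intro ballI allI impI)
  fix i t assume i: "i \<in> states S" and t: "u \<le> t"
  let ?g = "\<lambda>u. \<Sum>\<^sub>\<infinity>j\<in>states S. A_mat S q u i j * p u j"
  have "\<forall>r\<ge>s. ?g absolutely_integrable_on {s..r} \<and> p r i = p s i + integral {s..r} ?g"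
    using p i unfolding solves_forward_def by blast
  then have g: "?g absolutely_integrable_on {s..t}" "p t i = p s i + integral {s..t} ?g"
    "p u i = p s i + integral {s..u} ?g"
    using t \<open>s \<le> u\<close> order_trans[OF \<open>s \<le> u\<close> t] by blast+
  have "integral {s..u} ?g + integral {u..t} ?g = integral {s..t} ?g"
    using g(1) t \<open>s \<le> u\<close>
    by (intro Henstock_Kurzweil_Integration.integral_combine) (auto simp: absolutely_integrable_on_def)
  then have "p t i = p u i + integral {u..t} ?g"
    using g(2,3) by linarith
  moreover have "?g absolutely_integrable_on {u..t}"
    using \<open>s \<le> u\<close> by (intro absolutely_integrable_on_subinterval[OF g(1)]) auto
  ultimately show "?g absolutely_integrable_on {u..t} \<and> p t i = p u i + integral {u..t} ?g"
    by blast
qed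

lemma state_probabilities_restart:
  "state_probabilities S q s p \<Longrightarrow> s \<le> u \<Longrightarrow> state_probabilities S q u p"
  using solves_forward_restart[of S q s p u] by (auto simp: state_probabilities_def)

lemma apply_diff_vec:
  fixes m :: "nat \<Rightarrow> real"
  assumes "\<And>j. j \<in> A \<Longrightarrow> \<bar>m j\<bar> \<le> L" "x summable_on A" "y summable_on A"
  shows "(\<Sum>\<^sub>\<infinity>j\<in>A. m j * (x j - y j)) = (\<Sum>\<^sub>\<infinity>j\<in>A. m j * x j) - (\<Sum>\<^sub>\<infinity>j\<in>A. m j * y j)"
  unfolding right_diff_distrib
  using assms by (intro infsumI has_sum_diff_real has_sum_infsum summable_on_bounded_mult) auto

lemma apply_diff_mat:
  fixes m :: "nat \<Rightarrow> real"
  assumes "\<And>j. j \<in> A \<Longrightarrow> \<bar>m j\<bar> \<le> L" "\<And>j. j \<in> A \<Longrightarrow> \<bar>m' j\<bar> \<le> L'" "x summable_on A"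
  shows "(\<Sum>\<^sub>\<infinity>j\<in>A. (m j - m' j) * x j) = (\<Sum>\<^sub>\<infinity>j\<in>A. m j * x j) - (\<Sum>\<^sub>\<infinity>j\<in>A. m' j * x j)"
  unfolding left_diff_distrib
  using assms by (intro infsumI has_sum_diff_real has_sum_infsum summable_on_bounded_mult) auto

context tail_weights
begin

lemma bounded_generatorI:
  assumes cols: "\<And>j. j \<in> states S \<Longrightarrow> null_sum S (\<lambda>k. m k j)"
    and "opnorm_1D S d (\<lambda>i j. m i j - m i 0) \<le> ennreal B" "0 \<le> B"
    and "norm_1D S d (\<lambda>k. m k 0) \<le> ennreal F" "0 \<le> F"
  shows "bounded_generator S d m B F"
  using opnorm_1D_column[OF cols assms(2,3)] norm_1D_le_iff[OF cols[of 0] assms(5)] assms(4)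
  by (simp add: bounded_generator_def)

lemma bounded_generator_diff:
  assumes m: "bounded_generator S d m B F" and m': "bounded_generator S d m' B' F'"
  shows "bounded_generator S d (\<lambda>k j. m k j - m' k j) (B + B') (F + F')"
  unfolding bounded_generator_def
proof (intro conjI ballI)
  fix j assume "j \<in> pos_states S"
  then have "wbound S d (\<lambda>k. (m k j - m k (j - 1)) - (m' k j - m' k (j - 1))) (B * d j + B' * d j)"
    using m m' by (intro wbound_diff) (auto simp: bounded_generator_def)
  then show "wbound S d (\<lambda>k. m k j - m' k j - (m k (j - 1) - m' k (j - 1))) ((B + B') * d j)"
    by (simp add: algebra_simps)
next
  show "wbound S d (\<lambda>k. m k 0 - m' k 0) (F + F')"
    using m m' by (intro wbound_diff) (auto simp: bounded_generator_def)
qed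

end

section \<open>Propagation of weighted moments\<close>

context tail_weights
begin

lemma bounded_generator_column:
  assumes gen: "bounded_generator S d m B F" and "j \<in> states S"
  shows "wbound S d (\<lambda>k. m k j) (F + B * (\<Sum>l=1..j. d l))"
  using \<open>j \<in> states S\<close>
proof (induction j)
  case 0
  then show ?case using gen by (simp add: bounded_generator_def)
next
  case (Suc j)
  then have "wbound S d (\<lambda>k. m k j) (F + B * (\<Sum>l=1..j. d l))"
    using states_downward[of "Suc j" S j] by simp
  moreover have "wbound S d (\<lambda>k. m k (Suc j) - m k j) (B * d (Suc j))"
    using gen Suc.prems by (auto simp: bounded_generator_def pos_states_eq dest!: bspec[where x = "Suc j"])
  ultimately have "wbound S d (\<lambda>k. m k j + (m k (Suc j) - m k j))
      (F + B * (\<Sum>l=1..j. d l) + B * d (Suc j))"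
    by (rule wbound_add)
  then show ?case by (simp add: algebra_simps)
qed

lemma wbound_minus_originI:
  assumes p: "prob_vec S p"
    and le: "\<And>J. (\<Sum>i\<in>{1..J} \<inter> pos_states S. d i * (1 - cum p i)) \<le> K"
  shows "wbound S d (\<lambda>k. p k - origin k) K"
  unfolding wbound_def
proof (intro allI impI)
  fix F assume F: "finite F" "F \<subseteq> pos_states S"
  have "(\<Sum>i\<in>F. d i * \<bar>cum (\<lambda>k. p k - origin k) i\<bar>) = (\<Sum>i\<in>F. d i * (1 - cum p i))"
  proof (intro sum.cong refl)
    fix i assume "i \<in> F"
    then have "i \<in> pos_states S" "0 < i" using F by (auto simp: pos_states_eq)
    then show "d i * \<bar>cum (\<lambda>k. p k - origin k) i\<bar> = d i * (1 - cum p i)"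
      using prob_tail(2)[OF p, of i] by (simp add: cum_diff cum_origin)
  qed
  also have "\<dots> \<le> (\<Sum>i\<in>{1..Max F} \<inter> pos_states S. d i * (1 - cum p i))"
  proof (rule sum_mono2)
    show "F \<subseteq> {1..Max F} \<inter> pos_states S"
      using F by (auto simp: pos_states_eq Suc_le_eq)
    show "0 \<le> d i * (1 - cum p i)" if "i \<in> {1..Max F} \<inter> pos_states S - F" for i
      using that weight_nonneg prob_tail(2)[OF p] by (intro mult_nonneg_nonneg) auto
  qed auto
  also have "\<dots> \<le> K" by (rule le)
  finally show "(\<Sum>i\<in>F. d i * \<bar>cum (\<lambda>k. p k - origin k) i\<bar>) \<le> K" .
qed

text \<open>The weighted norm of a probability vector is its moment with respect to the function
  \<open>j \<mapsto> d 1 + \<dots> + d j\<close>. A bounded generator lets this function grow at most linearly in itself, and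
  stopping its growth at \<open>J\<close> preserves the estimate: above \<open>J\<close> the function is maximal, hence its
  drift is at most zero. This gives a bound that does not depend on \<open>J\<close> for moments that are
  finite a priori.\<close>

lemma truncated_moment_drift:
  fixes J :: nat
  assumes reg: "regular_rates S q L u" and gen: "bounded_generator S d (A_mat S q u) B F"
    and p: "prob_vec S p" and BF: "0 \<le> B" "0 \<le> F"
  defines "I \<equiv> {1..J} \<inter> pos_states S"
  shows "(\<Sum>i\<in>I. d i * - cum (\<lambda>k. \<Sum>\<^sub>\<infinity>j\<in>states S. A_mat S q u k j * p j) i)
    \<le> F + B * (\<Sum>i\<in>I. d i * (1 - cum p i))"
proof -
  let ?a = "A_mat S q u"
  define \<beta> where "\<beta> \<equiv> \<lambda>j. \<Sum>i\<in>I. d i * - (\<Sum>k<i. ?a k j)"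
  define w where "w \<equiv> \<lambda>j. \<Sum>i\<in>I. d i * (if i \<le> j then 1 else 0)"
  have I: "finite I" "I \<subseteq> pos_states S" by (auto simp: I_def)
  have p1: "(p has_sum 1) (states S)" and p0: "\<And>j. j \<in> states S \<Longrightarrow> 0 \<le> p j"
    using p by (auto simp: prob_vec_def)
  have "((\<lambda>j. ?a k j * p j) has_sum (\<Sum>\<^sub>\<infinity>j\<in>states S. ?a k j * p j)) (states S)"
    if "k \<in> states S" for k
    using has_sum_imp_summable[OF p1] A_mat_bounded[OF reg that]
    by (intro has_sum_infsum summable_on_bounded_mult)
  then have "((\<lambda>j. \<Sum>k<i. ?a k j * p j) has_sum
      cum (\<lambda>k. \<Sum>\<^sub>\<infinity>j\<in>states S. ?a k j * p j) i) (states S)" if "i \<in> I" for i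
    unfolding cum_def using I that pos_states_downward[of i S] by (intro has_sum_finite_sum) auto
  from has_sum_finite_sum[OF I(1) has_sum_cmult_right[OF has_sum_uminusI[OF this]]]
  have drift: "((\<lambda>j. \<beta> j * p j) has_sum
      (\<Sum>i\<in>I. d i * - cum (\<lambda>k. \<Sum>\<^sub>\<infinity>j\<in>states S. ?a k j * p j) i)) (states S)"
    unfolding \<beta>_def sum_distrib_right by (simp add: sum_distrib_right sum_distrib_left mult_ac sum_negf)
  have "((\<lambda>j. \<Sum>i\<in>I. d i * ((if i \<le> j then 1 else 0) * p j)) has_sum
      (\<Sum>i\<in>I. d i * (1 - cum p i))) (states S)"
    using I prob_tail(1)[OF p] by (intro has_sum_finite_sum has_sum_cmult_right) auto
  then have "((\<lambda>j. w j * p j) has_sum (\<Sum>i\<in>I. d i * (1 - cum p i))) (states S)"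
    by (simp add: w_def sum_distrib_right mult.assoc)
  from has_sum_add[OF has_sum_cmult_right[OF p1, of F] has_sum_cmult_right[OF this, of B]]
  have moment: "((\<lambda>j. (F + B * w j) * p j) has_sum (F + B * (\<Sum>i\<in>I. d i * (1 - cum p i)))) (states S)"
    by (simp add: distrib_right mult.assoc)
  have "\<beta> j \<le> F + B * w j" if j: "j \<in> states S" for j
  proof (cases "j \<le> J")
    case True
    have "\<beta> j \<le> (\<Sum>i\<in>I. d i * \<bar>cum (\<lambda>k. ?a k j) i\<bar>)"
      unfolding \<beta>_def cum_def using I weight_nonneg by (intro sum_mono mult_left_mono) auto
    also have "\<dots> \<le> F + B * (\<Sum>l=1..j. d l)"
      by (rule wboundD[OF bounded_generator_column[OF gen j] I])
    also have "(\<Sum>l=1..j. d l) = w j"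
    proof -
      have "{l \<in> I. l \<le> j} = {1..j}"
        using True states_downward[OF j] by (auto simp: I_def pos_states_eq)
      moreover have "w j = (\<Sum>i\<in>I. if i \<le> j then d i else 0)"
        unfolding w_def by (intro sum.cong) auto
      ultimately show ?thesis using I by (simp flip: sum.inter_filter)
    qed
    finally show ?thesis .
  next
    case False
    have "0 \<le> (\<Sum>k<i. ?a k j)" if "i \<in> I" for i
      using that False I pos_states_downward[of i S] j
      by (intro sum_nonneg A_mat_nonneg[OF reg]) (auto simp: I_def)
    then have "\<beta> j \<le> 0"
      unfolding \<beta>_def using I weight_nonneg by (intro sum_nonpos mult_nonneg_nonpos) auto
    moreover have "0 \<le> w j"
      unfolding w_def using I weight_nonneg by (intro sum_nonneg mult_nonneg_nonneg) auto
    ultimately show ?thesis using BF by (smt (verit) mult_nonneg_nonneg)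
  qed
  then show ?thesis
    using p0 by (intro has_sum_mono[OF drift moment] mult_right_mono) auto
qed

text \<open>The step length makes the feedback \<open>B h\<close> at most \<open>1 / 2\<close>, so the supremum of a truncated moment
  over the step can be absorbed into the left-hand side. The supremum is finite because of the
  truncation, and the resulting bound survives its removal.\<close>

lemma moment_growth:
  assumes p: "state_probabilities S q s p"
    and gen: "AE u in lebesgue. s \<le> u \<longrightarrow>
      regular_rates S q L u \<and> bounded_generator S d (A_mat S q u) B F"
    and R: "wbound S d (\<lambda>k. p s k - origin k) R" and BF: "0 \<le> B" "0 \<le> F"
    and t: "s \<le> t" "t \<le> s + h" and h: "h = 1 / (2 * (B + 1))"
  shows "wbound S d (\<lambda>k. p t k - origin k) (2 * (R + h * F))"
proof (rule wbound_minus_originI)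
  have prob: "prob_vec S (p u)" if "s \<le> u" for u
    using p that by (simp add: state_probabilities_def)
  show "prob_vec S (p t)" by (rule prob[OF t(1)])
  fix J
  let ?I = "{1..J} \<inter> pos_states S" and ?v = "\<lambda>u k. \<Sum>\<^sub>\<infinity>j\<in>states S. A_mat S q u k j * p u j"
  define m where "m \<equiv> \<lambda>u. \<Sum>i\<in>?I. d i * (1 - cum (p u) i)"
  define \<sigma> where "\<sigma> \<equiv> SUP u\<in>{s..s + h}. m u"
  have h0: "0 \<le> h" "B * h \<le> 1 / 2" using BF by (auto simp: h field_simps)
  have int: "(\<lambda>u. ?v u k) integrable_on {s..r}" "p r k = p s k + integral {s..r} (\<lambda>u. ?v u k)"
    if "k \<in> states S" "s \<le> r" for k r
    using state_probabilities_integral[OF p that] by blast+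
  have m0: "0 \<le> m u" if "s \<le> u" for u
    unfolding m_def using weight_nonneg prob_tail(2)[OF prob[OF that]]
    by (intro sum_nonneg mult_nonneg_nonneg) auto
  have "m u \<le> (\<Sum>i\<in>?I. d i)" if "s \<le> u" for u
    unfolding m_def
  proof (rule sum_mono)
    fix i assume i: "i \<in> ?I"
    have "0 \<le> cum (p u) i"
      unfolding cum_def using prob[OF that] pos_states_downward[of i S] i
      by (intro sum_nonneg) (auto simp: prob_vec_def)
    then show "d i * (1 - cum (p u) i) \<le> d i"
      using weight_nonneg[of i] i by (simp add: mult_left_le)
  qed
  then have bdd: "bdd_above (m ` {s..s + h})" by (intro bdd_aboveI2) auto
  have le\<sigma>: "m u \<le> \<sigma>" if "u \<in> {s..s + h}" for u
    unfolding \<sigma>_def using that bdd by (intro cSUP_upper)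
  have mR: "m s \<le> R"
  proof -
    have "m s = (\<Sum>i\<in>?I. d i * \<bar>cum (\<lambda>k. p s k - origin k) i\<bar>)"
      unfolding m_def
    proof (intro sum.cong refl)
      fix i assume "i \<in> ?I"
      then show "d i * (1 - cum (p s) i) = d i * \<bar>cum (\<lambda>k. p s k - origin k) i\<bar>"
        using prob_tail(2)[OF prob[of s], of i] by (simp add: cum_diff cum_origin)
    qed
    also have "\<dots> \<le> R" by (intro wboundD[OF R]) auto
    finally show ?thesis .
  qed
  have step: "m r \<le> R + (F + B * \<sigma>) * (r - s)" if r: "s \<le> r" "r \<le> s + h" for r
  proof -
    let ?D = "\<lambda>u. \<Sum>i\<in>?I. d i * - cum (?v u) i"
    have ci: "(\<lambda>u. cum (?v u) i) integrable_on {s..r}"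
      and cm: "cum (p r) i = cum (p s) i + integral {s..r} (\<lambda>u. cum (?v u) i)" if "i \<in> ?I" for i
    proof -
      show "(\<lambda>u. cum (?v u) i) integrable_on {s..r}"
        unfolding cum_def using that pos_states_downward[of i S] int(1)[OF _ r(1)]
        by (intro integrable_sum) auto
      have "integral {s..r} (\<lambda>u. cum (?v u) i) = (\<Sum>k<i. integral {s..r} (\<lambda>u. ?v u k))"
        unfolding cum_def using that pos_states_downward[of i S] int(1)[OF _ r(1)]
        by (intro integral_sum) auto
      moreover have "cum (p r) i = cum (\<lambda>k. p s k + integral {s..r} (\<lambda>u. ?v u k)) i"
        using that by (intro cum_cong[where S = S] int(2)[OF _ r(1)]) auto
      ultimately show "cum (p r) i = cum (p s) i + integral {s..r} (\<lambda>u. cum (?v u) i)"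
        by (simp add: cum_def sum.distrib)
    qed
    have "m r = m s + (\<Sum>i\<in>?I. d i * - integral {s..r} (\<lambda>u. cum (?v u) i))"
      by (simp add: m_def cm algebra_simps sum.distrib sum_subtractf sum_negf)
    also have "(\<Sum>i\<in>?I. d i * - integral {s..r} (\<lambda>u. cum (?v u) i)) = integral {s..r} ?D"
      by (subst integral_sum) (auto intro!: integrable_on_mult_right integrable_neg ci)
    also have "\<dots> \<le> (F + B * \<sigma>) * (r - s)"
    proof (rule integral_le_const_AE[OF _ r(1)])
      show "?D integrable_on {s..r}"
        by (intro integrable_sum integrable_on_mult_right integrable_neg ci) auto
      have "?D u \<le> F + B * \<sigma>"
        if u: "u \<in> {s..r}" and "regular_rates S q L u" "bounded_generator S d (A_mat S q u) B F" for u
      proof -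
        have "?D u \<le> F + B * m u"
          unfolding m_def using that prob[of u] BF by (intro truncated_moment_drift) auto
        also have "\<dots> \<le> F + B * \<sigma>"
          using le\<sigma>[of u] u r BF by (simp add: mult_left_mono)
        finally show ?thesis .
      qed
      then show "AE u in lebesgue. u \<in> {s..r} \<longrightarrow> ?D u \<le> F + B * \<sigma>"
        using gen by (auto elim!: eventually_mono)
    qed
    finally show ?thesis using mR by simp
  qed
  have "\<sigma> \<le> R + F * h + \<sigma> / 2"
    unfolding \<sigma>_def
  proof (rule cSUP_least, goal_cases)
    case (2 u)
    have "0 \<le> \<sigma>" using m0[of s] le\<sigma>[of s] h0 by auto
    have "m u \<le> R + (F + B * \<sigma>) * (u - s)" using step 2 by auto
    also have "\<dots> \<le> R + (F + B * \<sigma>) * h"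
      using 2 BF \<open>0 \<le> \<sigma>\<close> by (auto intro!: mult_left_mono)
    also have "\<dots> \<le> R + F * h + \<sigma> / 2"
      using mult_right_mono[OF h0(2) \<open>0 \<le> \<sigma>\<close>] by (simp add: algebra_simps)
    finally show ?case by (simp add: \<sigma>_def)
  qed (use h0 in auto)
  then have "\<sigma> \<le> 2 * (R + h * F)" by (simp add: mult.commute)
  then show "(\<Sum>i\<in>?I. d i * (1 - cum (p t) i)) \<le> 2 * (R + h * F)"
    using le\<sigma>[of t] t by (simp add: m_def)
qed

lemma moment_locally_bounded:
  assumes p: "state_probabilities S q s p"
    and gen: "AE u in lebesgue. s \<le> u \<longrightarrow>
      regular_rates S q L u \<and> bounded_generator S d (A_mat S q u) B F"
    and R: "wbound S d (\<lambda>k. p s k - origin k) R" and BF: "0 \<le> B" "0 \<le> F"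
  shows "\<exists>K. \<forall>t\<in>{s..T}. wbound S d (\<lambda>k. p t k - origin k) K"
proof -
  define h where "h = 1 / (2 * (B + 1))"
  have h: "0 < h" using BF by (simp add: h_def)
  have "\<exists>K. \<forall>t\<in>{s..s + real n * h}. wbound S d (\<lambda>k. p t k - origin k) K" for n
  proof (induction n)
    case 0
    then show ?case using R by auto
  next
    case (Suc n)
    then obtain K where K: "\<And>t. t \<in> {s..s + real n * h} \<Longrightarrow> wbound S d (\<lambda>k. p t k - origin k) K"
      by blast
    let ?s = "s + real n * h"
    have s: "s \<le> ?s" using h by simp
    have "wbound S d (\<lambda>k. p t k - origin k) (max K (2 * (K + h * F)))" if t: "t \<in> {s..s + real (Suc n) * h}" for t
    proof (cases "t \<le> ?s")
      case True
      then show ?thesis using t by (intro wbound_mono[OF K]) auto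
    next
      case False
      then have t': "?s \<le> t" "t \<le> ?s + h" using t by (simp_all add: distrib_right)
      have gen': "AE u in lebesgue. ?s \<le> u \<longrightarrow>
          regular_rates S q L u \<and> bounded_generator S d (A_mat S q u) B F"
        using gen by (rule eventually_mono) (use s in auto)
      have "?s \<in> {s..?s}" using s by simp
      from moment_growth[OF state_probabilities_restart[OF p s] gen' K[OF this] BF t' h_def]
      show ?thesis by (rule wbound_mono) simp
    qed
    then show ?case by blast
  qed
  moreover obtain n where "(T - s) / h \<le> real n" using real_arch_simple by blast
  then have "T \<le> s + real n * h" using h by (simp add: field_simps)
  ultimately show ?thesis by (meson atLeastAtMost_iff order_trans)
qed

end

section \<open>Transport of signed vectors by the transition probabilities\<close>

text \<open>Absolute convergence in \<open>a\<close> and a uniform bound for the sums over \<open>b\<close> justify every exchange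
  of two sums over states below.\<close>

lemma mixture_has_sum:
  fixes x :: "'a \<Rightarrow> real" and g :: "'a \<Rightarrow> 'b \<Rightarrow> real"
  assumes x: "x summable_on A"
    and g: "\<And>a. a \<in> A \<Longrightarrow> g a summable_on B"
    and C: "\<And>a. a \<in> A \<Longrightarrow> (\<Sum>\<^sub>\<infinity>b\<in>B. \<bar>g a b\<bar>) \<le> C"
  shows "((\<lambda>b. \<Sum>\<^sub>\<infinity>a\<in>A. x a * g a b) has_sum (\<Sum>\<^sub>\<infinity>a\<in>A. x a * (\<Sum>\<^sub>\<infinity>b\<in>B. g a b))) B"
proof -
  have "(\<lambda>z. norm ((\<lambda>(a, b). x a * g a b) z)) summable_on (A \<times> B)"
  proof (rule iffD2[OF Infinite_Sum.abs_summable_on_Sigma_iff], intro conjI ballI)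
    fix a assume a: "a \<in> A"
    show "(\<lambda>b. norm (case (a, b) of (a, b) \<Rightarrow> x a * g a b)) summable_on B"
      using summable_on_real_abs[OF g[OF a]] by (simp add: abs_mult summable_on_cmult_right)
  next
    have 1: "(\<Sum>\<^sub>\<infinity>b\<in>B. norm (case (a, b) of (a, b) \<Rightarrow> x a * g a b)) = \<bar>x a\<bar> * (\<Sum>\<^sub>\<infinity>b\<in>B. \<bar>g a b\<bar>)"
      for a by (simp add: abs_mult infsum_cmult_right')
    have 2: "0 \<le> (\<Sum>\<^sub>\<infinity>b\<in>B. \<bar>g a b\<bar>)" for a by (rule infsum_nonneg) simp
    show "(\<lambda>a. norm (\<Sum>\<^sub>\<infinity>b\<in>B. norm (case (a, b) of (a, b) \<Rightarrow> x a * g a b))) summable_on A"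
      unfolding 1
      by (rule Infinite_Sum.abs_summable_on_comparison_test'[where g = "\<lambda>a. C * \<bar>x a\<bar>"])
        (use 2 C summable_on_real_abs[OF x] in
          \<open>auto simp: abs_mult mult.commute[of C] intro!: mult_left_mono summable_on_cmult_left\<close>)
  qed
  then have sm: "(\<lambda>(a, b). x a * g a b) summable_on (A \<times> B)"
    by (rule abs_summable_summable)
  then have sm': "(\<lambda>(b, a). x a * g a b) summable_on (B \<times> A)"
    by (subst (asm) summable_on_swap) (simp add: case_prod_unfold)
  have 1: "(\<lambda>b. \<Sum>\<^sub>\<infinity>a\<in>A. x a * g a b) summable_on B"
    using summable_on_Sigma_banach[OF sm'] by simp
  have 2: "(\<Sum>\<^sub>\<infinity>b\<in>B. \<Sum>\<^sub>\<infinity>a\<in>A. x a * g a b) = (\<Sum>\<^sub>\<infinity>a\<in>A. x a * (\<Sum>\<^sub>\<infinity>b\<in>B. g a b))"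
    unfolding infsum_cmult_right'[symmetric] by (rule infsum_swap_banach[OF sm, symmetric])
  from has_sum_infsum[OF 1] show ?thesis unfolding 2 .
qed

text \<open>This is the evolution operator of the forward system from time \<open>\<tau>\<close> to \<open>t\<close>, on arbitrary absolutely
  summable vectors instead of probability vectors.\<close>

definition transport ::
    "enat \<Rightarrow> (real \<Rightarrow> real \<Rightarrow> nat \<Rightarrow> nat \<Rightarrow> real) \<Rightarrow> real \<Rightarrow> real \<Rightarrow> (nat \<Rightarrow> real) \<Rightarrow> nat \<Rightarrow> real" where
  "transport S P \<tau> t x k = (\<Sum>\<^sub>\<infinity>j\<in>states S. P \<tau> t j k * x j)"

context inhom_ctmc
begin

context
  fixes \<tau> t :: real
  assumes times: "0 \<le> \<tau>" "\<tau> \<le> t"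
begin

lemma transition_prob_vec: "j \<in> states S \<Longrightarrow> prob_vec S (P \<tau> t j)"
  using transition_forward[of \<tau> j] times by (simp add: state_probabilities_def)

lemma transition_nonneg: "j \<in> states S \<Longrightarrow> k \<in> states S \<Longrightarrow> 0 \<le> P \<tau> t j k"
  and transition_sum: "j \<in> states S \<Longrightarrow> (P \<tau> t j has_sum 1) (states S)"
  using transition_prob_vec by (auto simp: prob_vec_def)

lemma transition_le_1:
  assumes j: "j \<in> states S" and k: "k \<in> states S"
  shows "\<bar>P \<tau> t j k\<bar> \<le> 1"
proof -
  have "(P \<tau> t j has_sum (\<Sum>k\<in>{k}. P \<tau> t j k)) {k}" by (rule has_sum_finite) simp
  from has_sum_mono'[OF this transition_sum[OF j]] show ?thesis
    using k transition_nonneg[OF j] by auto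
qed

lemma transition_weighted:
  assumes j: "j \<in> states S" and m: "\<And>b. b \<in> states S \<Longrightarrow> \<bar>m b\<bar> \<le> C"
  shows "(\<lambda>b. m b * P \<tau> t j b) summable_on states S"
    and "(\<Sum>\<^sub>\<infinity>b\<in>states S. \<bar>m b * P \<tau> t j b\<bar>) \<le> C"
    and "\<bar>\<Sum>\<^sub>\<infinity>b\<in>states S. m b * P \<tau> t j b\<bar> \<le> C"
proof -
  note sm = has_sum_imp_summable[OF transition_sum[OF j]]
  show 1: "(\<lambda>b. m b * P \<tau> t j b) summable_on states S"
    using sm m by (rule summable_on_bounded_mult)
  have C: "((\<lambda>b. C * P \<tau> t j b) has_sum C) (states S)"
    using has_sum_cmult_right[OF transition_sum[OF j], of C] by simp
  have le: "\<bar>m b * P \<tau> t j b\<bar> \<le> C * P \<tau> t j b" if "b \<in> states S" for b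
    using m[OF that] transition_nonneg[OF j that] by (simp add: abs_mult mult_right_mono)
  show "(\<Sum>\<^sub>\<infinity>b\<in>states S. \<bar>m b * P \<tau> t j b\<bar>) \<le> C"
    using has_sum_mono[OF has_sum_infsum[OF summable_on_real_abs[OF 1]] C le] .
  show "\<bar>\<Sum>\<^sub>\<infinity>b\<in>states S. m b * P \<tau> t j b\<bar> \<le> C"
    using norm_infsum_le[OF has_sum_infsum[OF 1] C] le by simp
qed

lemma transport_summand:
  "x summable_on states S \<Longrightarrow> k \<in> states S \<Longrightarrow> (\<lambda>j. P \<tau> t j k * x j) summable_on states S"
  by (rule summable_on_bounded_mult[where L = 1]) (auto intro: transition_le_1)

lemma transport_add:
  assumes "x summable_on states S" "y summable_on states S" "k \<in> states S"
  shows "transport S P \<tau> t (\<lambda>j. x j + y j) k = transport S P \<tau> t x k + transport S P \<tau> t y k"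
  unfolding transport_def distrib_left using assms transport_summand by (intro infsum_add) auto

lemma transport_has_sum:
  assumes x: "(x has_sum r) (states S)"
  shows "(transport S P \<tau> t x has_sum r) (states S)"
proof -
  have "(P \<tau> t a) summable_on states S" "(\<Sum>\<^sub>\<infinity>b\<in>states S. \<bar>P \<tau> t a b\<bar>) \<le> 1" if "a \<in> states S" for a
    using transition_weighted(1,2)[OF that, of "\<lambda>b. 1" 1] by auto
  from mixture_has_sum[OF has_sum_imp_summable[OF x] this] show ?thesis
    using x unfolding transport_def
    by (simp add: mult.commute infsumI[OF transition_sum] infsumI[OF x] cong: infsum_cong)
qed

end

lemma transport_initial:
  assumes "0 \<le> \<tau>" and k: "k \<in> states S"
  shows "transport S P \<tau> \<tau> x k = x k"
proof -
  have "((\<lambda>j. P \<tau> \<tau> j k * x j) has_sum x k) (states S)"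
    using assms by (intro has_sum_finite_neutralI[of "{k}"]) (auto simp: transition_initial)
  then show ?thesis unfolding transport_def by (rule infsumI)
qed

lemma transport_transport:
  assumes times: "0 \<le> \<tau>" "\<tau> \<le> u" "u \<le> t" and x: "x summable_on states S" and k: "k \<in> states S"
  shows "transport S P u t (transport S P \<tau> u x) k = transport S P \<tau> t x k"
proof -
  have u: "0 \<le> u" using times by simp
  let ?g = "\<lambda>a b. P u t b k * P \<tau> u a b"
  have "?g a summable_on states S" "(\<Sum>\<^sub>\<infinity>b\<in>states S. \<bar>?g a b\<bar>) \<le> 1" if "a \<in> states S" for a
    using transition_weighted(1,2)[OF times(1,2) that, of "\<lambda>b. P u t b k" 1]
      transition_le_1[OF u times(3) _ k] by auto
  from mixture_has_sum[OF x this]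
  have "(\<Sum>\<^sub>\<infinity>b\<in>states S. \<Sum>\<^sub>\<infinity>a\<in>states S. x a * ?g a b)
      = (\<Sum>\<^sub>\<infinity>a\<in>states S. x a * (\<Sum>\<^sub>\<infinity>b\<in>states S. ?g a b))"
    by (intro infsumI) auto
  moreover have "(\<Sum>\<^sub>\<infinity>a\<in>states S. x a * ?g a b) = P u t b k * transport S P \<tau> u x b" for b
    unfolding transport_def infsum_cmult_right'[symmetric] by (simp add: mult_ac)
  moreover have "(\<Sum>\<^sub>\<infinity>b\<in>states S. ?g a b) = P \<tau> t a k" if "a \<in> states S" for a
    using chapman_kolmogorov[OF times that k] by (intro infsumI) (simp add: mult.commute)
  ultimately show ?thesis
    unfolding transport_def[of S P u] transport_def[of S P \<tau> t] by (simp add: mult.commute cong: infsum_cong)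
qed

text \<open>The forward equation is linear, so a mixture of the transition probabilities solves it, too.
  The rates are bounded, which dominates the infinite mixture uniformly in time.\<close>

lemma transport_solves:
  assumes times: "0 \<le> \<tau>" "\<tau> \<le> t" and x: "x summable_on states S" and k: "k \<in> states S"
  defines "v \<equiv> \<lambda>u. \<Sum>\<^sub>\<infinity>j\<in>states S. A_mat S q u k j * transport S P \<tau> u x j"
  shows "v integrable_on {\<tau>..t}"
    and "transport S P \<tau> t x k = x k + integral {\<tau>..t} v"
proof -
  define e where "e \<equiv> \<lambda>a. if a \<in> states S then x a else 0"
  define G where "G \<equiv> \<lambda>u a. \<Sum>\<^sub>\<infinity>b\<in>states S. A_mat S q u k b * P \<tau> u a b"
  define f where "f \<equiv> \<lambda>n u. \<Sum>a<n. e a * G u a"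
  obtain N where N: "negligible N" "\<And>u. u \<notin> N \<Longrightarrow> 0 \<le> u \<longrightarrow> regular_rates S q L u"
    using AE_lebesgue_obtain_negligible[OF AE_regular_rates] by blast
  define X where "X \<equiv> \<Sum>\<^sub>\<infinity>a\<in>states S. \<bar>x a\<bar>"
  have eX: "(\<Sum>a<n. \<bar>e a\<bar>) \<le> X" for n
  proof -
    have "(\<Sum>a<n. \<bar>e a\<bar>) = (\<Sum>a\<in>{..<n} \<inter> states S. \<bar>x a\<bar>)"
      by (intro sum.mono_neutral_cong_right) (auto simp: e_def)
    also have "\<dots> \<le> X"
      unfolding X_def by (rule finite_sum_le_infsum[OF summable_on_real_abs[OF x]]) auto
    finally show ?thesis .
  qed
  have G: "(\<lambda>u. G u a) integrable_on {\<tau>..t}" "integral {\<tau>..t} (\<lambda>u. G u a) = P \<tau> t a k - P \<tau> \<tau> a k"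
    if "a \<in> states S" for a
    using state_probabilities_integral[OF transition_forward[OF times(1) that] k times(2)]
    by (auto simp: G_def)
  have good: "regular_rates S q L u" if "u \<in> {\<tau>..t} - N" for u using N(2) that times by auto
  have A: "\<bar>A_mat S q u k b\<bar> \<le> L" if "u \<in> {\<tau>..t} - N" "b \<in> states S" for u b
    using A_mat_bounded[OF good[OF that(1)] k that(2)] .
  have GL: "\<bar>G u a\<bar> \<le> L" if u: "u \<in> {\<tau>..t} - N" and a: "a \<in> states S" for u a
    unfolding G_def using u times a by (intro transition_weighted(3) A) auto
  have L: "0 \<le> L" if "u \<in> {\<tau>..t} - N" for u
    using A[OF that k] by linarith
  have v: "v u = (\<Sum>\<^sub>\<infinity>a\<in>states S. x a * G u a)" if u: "u \<in> {\<tau>..t} - N" for u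
  proof -
    have t: "\<tau> \<le> u" using u by auto
    let ?g = "\<lambda>a b. A_mat S q u k b * P \<tau> u a b"
    have "?g a summable_on states S" "(\<Sum>\<^sub>\<infinity>b\<in>states S. \<bar>?g a b\<bar>) \<le> L" if "a \<in> states S" for a
      using transition_weighted(1,2)[OF times(1) t that A[OF u]] by auto
    from mixture_has_sum[OF x this]
    have "(\<Sum>\<^sub>\<infinity>b\<in>states S. \<Sum>\<^sub>\<infinity>a\<in>states S. x a * ?g a b) = (\<Sum>\<^sub>\<infinity>a\<in>states S. x a * G u a)"
      unfolding G_def by (intro infsumI) auto
    moreover have "(\<Sum>\<^sub>\<infinity>a\<in>states S. x a * ?g a b) = A_mat S q u k b * transport S P \<tau> u x b" for b
      unfolding transport_def infsum_cmult_right'[symmetric] by (simp add: mult_ac)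
    ultimately show ?thesis by (simp add: v_def)
  qed
  have partial: "(\<lambda>n. \<Sum>a<n. e a * y a) \<longlonglongrightarrow> (\<Sum>\<^sub>\<infinity>a\<in>states S. x a * y a)"
    if y: "\<And>a. a \<in> states S \<Longrightarrow> \<bar>y a\<bar> \<le> C" for y C
  proof -
    have "(\<lambda>a. x a * y a) summable_on states S"
      using summable_on_bounded_mult[OF x y] by (simp add: mult.commute)
    then have "((\<lambda>a. x a * y a) has_sum (\<Sum>\<^sub>\<infinity>a\<in>states S. x a * y a)) (states S)" by simp
    also have "?this \<longleftrightarrow> ((\<lambda>a. e a * y a) has_sum (\<Sum>\<^sub>\<infinity>a\<in>states S. x a * y a)) UNIV"
      by (intro has_sum_cong_neutral) (auto simp: e_def)
    finally show ?thesis by (auto dest: has_sum_imp_sums simp: sums_def)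
  qed
  have fi: "(f n) integrable_on {\<tau>..t}" for n
    unfolding f_def e_def using G(1) by (intro integrable_sum) (auto intro!: integrable_on_mult_right)
  have fint: "integral {\<tau>..t} (f n) = (\<Sum>a<n. e a * (P \<tau> t a k - P \<tau> \<tau> a k))" for n
  proof -
    have "integral {\<tau>..t} (f n) = (\<Sum>a<n. integral {\<tau>..t} (\<lambda>u. e a * G u a))"
      unfolding f_def e_def using G(1) by (intro integral_sum) (auto intro!: integrable_on_mult_right)
    also have "\<dots> = (\<Sum>a<n. e a * (P \<tau> t a k - P \<tau> \<tau> a k))"
      by (intro sum.cong refl) (auto simp: e_def G(2))
    finally show ?thesis .
  qed
  \<comment> \<open>Exceptional times get the value \<open>0\<close>, so that domination and convergence hold everywhere.\<close>
  define f' where "f' \<equiv> \<lambda>n u. if u \<in> N then 0 else f n u"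
  define v' where "v' \<equiv> \<lambda>u. if u \<in> N then 0 else v u"
  have f'i: "(f' n) integrable_on {\<tau>..t}" "integral {\<tau>..t} (f' n) = integral {\<tau>..t} (f n)" for n
    by (auto simp: f'_def intro!: integrable_spike[OF fi N(1)] integral_spike[OF N(1)])
  have bound: "norm (f' n u) \<le> \<bar>L\<bar> * X" if u: "u \<in> {\<tau>..t}" for n u
  proof (cases "u \<in> N")
    case False
    then have u': "u \<in> {\<tau>..t} - N" using u by simp
    have "\<bar>f n u\<bar> \<le> (\<Sum>a<n. L * \<bar>e a\<bar>)"
      unfolding f_def
    proof (intro order_trans[OF sum_abs] sum_mono)
      fix a
      show "\<bar>e a * G u a\<bar> \<le> L * \<bar>e a\<bar>"
        using GL[OF u', of a] unfolding mult.commute[of L]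
        by (auto simp: e_def abs_mult intro: mult_left_mono)
    qed
    also have "\<dots> = L * (\<Sum>a<n. \<bar>e a\<bar>)" by (simp add: sum_distrib_left)
    also have "\<dots> \<le> \<bar>L\<bar> * X" using L[OF u'] eX[of n] by (simp add: mult_left_mono)
    finally show ?thesis using False by (simp add: f'_def)
  next
    case True
    then show ?thesis using eX[of 0] by (simp add: f'_def)
  qed
  have conv: "(\<lambda>n. f' n u) \<longlonglongrightarrow> v' u" if u: "u \<in> {\<tau>..t}" for u
  proof (cases "u \<in> N")
    case False
    then have u': "u \<in> {\<tau>..t} - N" using u by simp
    have "(\<lambda>n. f n u) \<longlonglongrightarrow> v u"
      unfolding f_def v[OF u'] by (rule partial[OF GL[OF u']])
    then show ?thesis using False by (simp add: f'_def v'_def)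
  qed (simp add: f'_def v'_def)
  have dc: "v' integrable_on {\<tau>..t}" "(\<lambda>n. integral {\<tau>..t} (f' n)) \<longlonglongrightarrow> integral {\<tau>..t} v'"
    using dominated_convergence[OF f'i(1) integrable_const_ivl bound conv] by blast+
  show "v integrable_on {\<tau>..t}"
    by (rule integrable_spike[OF dc(1) N(1)]) (simp add: v'_def)
  have vv: "integral {\<tau>..t} v' = integral {\<tau>..t} v"
    by (rule integral_spike[OF N(1)]) (simp add: v'_def)
  have "(\<lambda>n. \<Sum>a<n. e a * (P \<tau> t a k - P \<tau> \<tau> a k)) \<longlonglongrightarrow> transport S P \<tau> t x k - transport S P \<tau> \<tau> x k"
    unfolding right_diff_distrib sum_subtractf
    using transition_le_1[OF times _ k] transition_le_1[OF times(1) order_refl _ k]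
      partial[of "\<lambda>a. P \<tau> t a k" 1] partial[of "\<lambda>a. P \<tau> \<tau> a k" 1]
    by (auto intro!: tendsto_diff simp: transport_def mult.commute)
  moreover have "(\<lambda>n. \<Sum>a<n. e a * (P \<tau> t a k - P \<tau> \<tau> a k)) \<longlonglongrightarrow> integral {\<tau>..t} v"
    using dc(2) by (simp add: f'i(2) fint vv)
  ultimately have "transport S P \<tau> t x k - transport S P \<tau> \<tau> x k = integral {\<tau>..t} v"
    by (rule LIMSEQ_unique)
  then show "transport S P \<tau> t x k = x k + integral {\<tau>..t} v"
    unfolding transport_initial[OF times(1) k] by linarith
qed

end

section \<open>Membership in the weighted space\<close>

context tail_weights
begin

lemma norm_1D_minus_origin: "norm_1D S d (\<lambda>k. p k - origin k) = norm_1D S d p"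
proof -
  have "mat_vec (pos_states S) (D_mat d) (\<lambda>k. p k - origin k) = mat_vec (pos_states S) (D_mat d) p"
    unfolding mat_vec_def
    by (intro ext infsum_cong) (auto simp: origin_def pos_states_eq)
  then show ?thesis by (simp add: norm_1D_def)
qed

lemma l1D_iff:
  assumes p: "prob_vec S p"
  shows "p \<in> l1D S d \<longleftrightarrow> (\<exists>K. wbound S d (\<lambda>k. p k - origin k) K)"
proof -
  have "p summable_on states S" using p by (auto simp: prob_vec_def summable_on_def)
  then have "p summable_on pos_states S"
    by (rule summable_on_subset) (auto simp: pos_states_eq)
  then show ?thesis
    unfolding l1D_def using norm_1D_finite_iff[OF prob_minus_origin[OF p]]
    by (simp add: norm_1D_minus_origin)
qed

lemma l1D_diff:
  assumes p: "prob_vec S p" "p \<in> l1D S d" and p': "prob_vec S p'" "p' \<in> l1D S d"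
  shows "\<exists>R. wbound S d (\<lambda>k. p k - p' k) R"
proof -
  obtain K K' where "wbound S d (\<lambda>k. p k - origin k) K" "wbound S d (\<lambda>k. p' k - origin k) K'"
    using p p' l1D_iff by blast
  from wbound_diff[OF this] show ?thesis by auto
qed

lemma exp_weakly_ergodic_wbound:
  assumes erg: "exp_weakly_ergodic_1D S d q M a" and st: "0 \<le> s" "s \<le> t"
    and p: "state_probabilities S q s p" "p s \<in> l1D S d"
    and p': "state_probabilities S q s p'" "p' s \<in> l1D S d"
    and R: "wbound S d (\<lambda>k. p s k - p' s k) R"
  shows "wbound S d (\<lambda>k. p t k - p' t k) (M * exp (- a * (t - s)) * R)"
proof -
  have M: "0 \<le> M * exp (- a * (t - s))" and R0: "0 \<le> R"
    using erg wbound_nonneg[OF R] by (auto simp: exp_weakly_ergodic_1D_def)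
  have null: "null_sum S (\<lambda>k. p u k - p' u k)" if "s \<le> u" for u
    using p p' that by (intro prob_diff) (auto simp: state_probabilities_def)
  have "norm_1D S d (\<lambda>k. p t k - p' t k)
      \<le> ennreal (M * exp (- a * (t - s))) * norm_1D S d (\<lambda>k. p s k - p' s k)"
    using erg st p p' unfolding exp_weakly_ergodic_1D_def by blast
  also have "\<dots> \<le> ennreal (M * exp (- a * (t - s))) * ennreal R"
    using R norm_1D_le_iff[OF null[OF order_refl] R0] by (intro mult_left_mono) auto
  also have "\<dots> = ennreal (M * exp (- a * (t - s)) * R)"
    by (rule ennreal_mult[OF M R0, symmetric])
  finally show ?thesis
    using norm_1D_le_iff[OF null[OF st(2)]] M R0 by (metis mult_nonneg_nonneg)
qed

text \<open>The norm of the difference of the initial values is finite, so it can serve as the bound \<open>R\<close>.\<close>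

lemma exp_weakly_ergodicI:
  assumes Ma: "0 < M" "0 < a"
    and decay: "\<And>s t p p' R. \<lbrakk>0 \<le> s; s \<le> t; state_probabilities S q s p; state_probabilities S q s p';
      p s \<in> l1D S d; p' s \<in> l1D S d; wbound S d (\<lambda>k. p s k - p' s k) R\<rbrakk>
      \<Longrightarrow> wbound S d (\<lambda>k. p t k - p' t k) (M * exp (- a * (t - s)) * R)"
  shows "exp_weakly_ergodic_1D S d q M a"
  unfolding exp_weakly_ergodic_1D_def
proof (intro conjI allI impI Ma, elim conjE)
  fix s t p p' assume st: "0 \<le> s" "s \<le> t"
    and p: "state_probabilities S q s p" "state_probabilities S q s p'"
    and l1: "p s \<in> l1D S d" "p' s \<in> l1D S d"
  have prob: "prob_vec S (p u)" "prob_vec S (p' u)" if "s \<le> u" for u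
    using p that by (auto simp: state_probabilities_def)
  have null: "null_sum S (\<lambda>k. p u k - p' u k)" if "s \<le> u" for u
    by (rule prob_diff[OF prob[OF that]])
  define R where "R = enn2real (norm_1D S d (\<lambda>k. p s k - p' s k))"
  have "norm_1D S d (\<lambda>k. p s k - p' s k) < \<infinity>"
    unfolding norm_1D_finite_iff[OF null[OF order_refl]]
    using l1 by (intro l1D_diff prob) auto
  then have R: "norm_1D S d (\<lambda>k. p s k - p' s k) = ennreal R" by (simp add: R_def)
  have R0: "0 \<le> R" by (simp add: R_def)
  have "wbound S d (\<lambda>k. p s k - p' s k) R"
    using norm_1D_le_iff[OF null[OF order_refl] R0] R by simp
  from decay[OF st p l1 this] have "norm_1D S d (\<lambda>k. p t k - p' t k) \<le> ennreal (M * exp (- a * (t - s)) * R)"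
    using norm_1D_le_iff[OF null[OF st(2)]] Ma R0 by simp
  then show "norm_1D S d (\<lambda>k. p t k - p' t k)
      \<le> ennreal (M * exp (- a * (t - s))) * norm_1D S d (\<lambda>k. p s k - p' s k)"
    unfolding R using Ma R0 by (simp add: ennreal_mult)
qed

lemma wbound_unit_step:
  assumes j: "j \<in> pos_states S"
  shows "wbound S d (\<lambda>k. (if k = j then 1 else 0) - (if k = j - 1 then 1 else 0)) (d j)"
  unfolding wbound_def
proof (intro allI impI)
  fix F assume F: "finite F" "F \<subseteq> pos_states S"
  have "cum (\<lambda>k. (if k = j then 1 else 0) - (if k = j - 1 then 1 else 0)) i = (if i = j then -1 else 0)"
    for i using j by (auto simp: cum_def sum_subtractf pos_states_eq)
  then have "(\<Sum>i\<in>F. d i * \<bar>cum (\<lambda>k. (if k = j then 1 else 0) - (if k = j - 1 then 1 else 0)) i\<bar>)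
      = (\<Sum>i\<in>F. if i = j then d j else 0)"
    by (intro sum.cong) auto
  also have "\<dots> \<le> d j" using F weight_nonneg[OF j] by simp
  finally show "(\<Sum>i\<in>F. d i * \<bar>cum (\<lambda>k. (if k = j then 1 else 0) - (if k = j - 1 then 1 else 0)) i\<bar>) \<le> d j" .
qed

lemma wbound_unit_minus_origin:
  assumes "j \<in> states S"
  shows "wbound S d (\<lambda>k. (if k = j then 1 else 0) - origin k) (\<Sum>l=1..j. d l)"
  using assms
proof (induction j)
  case 0
  then show ?case by (simp add: origin_def wbound_def cum_def)
next
  case (Suc j)
  then have "j \<in> states S" "Suc j \<in> pos_states S"
    using states_downward[of "Suc j" S j] by (auto simp: pos_states_eq)
  from wbound_add[OF Suc.IH[OF this(1)] wbound_unit_step[OF this(2)]]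
  show ?case by (simp add: algebra_simps)
qed

end

section \<open>Perturbation of an exponentially ergodic chain\<close>

locale weighted_chain = inhom_ctmc S q L P Q X + tail_weights S d
  for S q L P Q X d
begin

lemma transition_l1D:
  assumes "0 \<le> \<tau>" and j: "j \<in> states S"
  shows "P \<tau> \<tau> j \<in> l1D S d"
proof -
  have "wbound S d (\<lambda>k. P \<tau> \<tau> j k - origin k) (\<Sum>l=1..j. d l)"
    using wbound_unit_minus_origin[OF j] transition_initial[OF assms(1) j]
    by (subst wbound_cong[where y = "\<lambda>k. (if k = j then 1 else 0) - origin k"]) auto
  then show ?thesis
    using l1D_iff[OF transition_prob_vec[OF assms(1) order_refl j]] by blast
qed

end

locale bounded_chain = weighted_chain +
  fixes B F :: real
  assumes bounded: "AE u in lebesgue. 0 \<le> u \<longrightarrow> bounded_generator S d (A_mat S q u) B F"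
    and B_nonneg: "0 \<le> B" and F_nonneg: "0 \<le> F"
begin

lemma AE_generator: "AE u in lebesgue. 0 \<le> u \<longrightarrow>
    regular_rates S q L u \<and> bounded_generator S d (A_mat S q u) B F"
  using AE_regular_rates bounded by eventually_elim auto

lemma solution_locally_bounded:
  assumes s: "0 \<le> s" and p: "state_probabilities S q s p" and l1: "p s \<in> l1D S d"
  shows "\<exists>U. \<forall>t\<in>{s..T}. wbound S d (\<lambda>k. p t k - origin k) U"
proof -
  have ps: "prob_vec S (p s)" using p by (simp add: state_probabilities_def)
  from l1 obtain R where "wbound S d (\<lambda>k. p s k - origin k) R" unfolding l1D_iff[OF ps] ..
  moreover have "AE u in lebesgue. s \<le> u \<longrightarrow>
      regular_rates S q L u \<and> bounded_generator S d (A_mat S q u) B F"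
    using AE_generator by eventually_elim (use s in auto)
  ultimately show ?thesis
    using moment_locally_bounded[OF p _ _ B_nonneg F_nonneg] by blast
qed

lemma solution_in_l1D:
  assumes "0 \<le> s" "s \<le> t" and p: "state_probabilities S q s p" and "p s \<in> l1D S d"
  shows "p t \<in> l1D S d"
proof -
  have "prob_vec S (p t)" using p assms(2) by (simp add: state_probabilities_def)
  from l1D_iff[OF this] solution_locally_bounded[OF assms(1,3,4), of t] assms(2)
  show ?thesis by auto
qed

end

locale ergodic_chain = bounded_chain S q L P Q X d B F
  for S q L P Q X d B F +
  fixes M a :: real
  assumes ergodic: "exp_weakly_ergodic_1D S d q M a"
begin

lemma M_pos: "0 < M" and a_pos: "0 < a"
  using ergodic by (auto simp: exp_weakly_ergodic_1D_def)

text \<open>Ergodicity is a statement about pairs of probability vectors. Applied to two neighbouring unit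
  vectors it bounds the column differences of the transition matrix, and hence the action of that
  matrix on every vector with sum zero.\<close>

lemma transport_wbound:
  assumes times: "0 \<le> \<tau>" "\<tau> \<le> t" and x: "null_sum S x" and R: "wbound S d x R"
  shows "wbound S d (transport S P \<tau> t x) (M * exp (- a * (t - \<tau>)) * R)"
proof -
  define K where "K = M * exp (- a * (t - \<tau>))"
  have K: "0 \<le> K" using M_pos by (simp add: K_def)
  have cols: "wbound S d (\<lambda>k. P \<tau> t j k - P \<tau> t (j - 1) k) (K * d j)" if j: "j \<in> pos_states S" for j
  proof -
    have j': "j \<in> states S" "j - 1 \<in> states S"
      using j pos_states_downward[OF j, of "j - 1"] by (auto simp: pos_states_eq)
    have "wbound S d (\<lambda>k. P \<tau> \<tau> j k - P \<tau> \<tau> (j - 1) k) (d j)"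
      using wbound_unit_step[OF j] transition_initial[OF times(1)] j'
      by (subst wbound_cong[where y = "\<lambda>k. (if k = j then 1 else 0) - (if k = j - 1 then 1 else 0)"]) auto
    from exp_weakly_ergodic_wbound[OF ergodic times
        transition_forward[OF times(1) j'(1)] transition_l1D[OF times(1) j'(1)]
        transition_forward[OF times(1) j'(2)] transition_l1D[OF times(1) j'(2)] this]
    show ?thesis by (simp add: K_def)
  qed
  have "wbound S d (\<lambda>k. \<Sum>\<^sub>\<infinity>j\<in>states S. P \<tau> t j k * x j) (K * R)"
    by (rule wbound_mat_apply[where L = 1, OF _ cols x R K]) (rule transition_le_1[OF times])
  then show ?thesis by (simp add: K_def transport_def[abs_def])
qed

text \<open>The predicate bounds the norm \<open>sup {exp (a (t - \<tau>)) \<parallel>transport \<tau> t x\<parallel> | t \<ge> \<tau>}\<close>. It is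
  equivalent to the weighted norm, with constants \<open>1\<close> and \<open>M\<close>, and adapted to the chain: transport
  from \<open>\<tau>\<close> to \<open>u\<close> contracts it by the factor \<open>exp (- a (u - \<tau>))\<close> without the constant \<open>M\<close>. Short time
  steps can therefore be iterated without accumulating powers of \<open>M\<close>.\<close>

definition adapted_bound :: "real \<Rightarrow> (nat \<Rightarrow> real) \<Rightarrow> real \<Rightarrow> bool" where
  "adapted_bound \<tau> x K \<longleftrightarrow> (\<forall>t\<ge>\<tau>. wbound S d (transport S P \<tau> t x) (exp (- a * (t - \<tau>)) * K))"

lemma adapted_boundI:
  assumes "0 \<le> \<tau>" "null_sum S x" "wbound S d x K"
  shows "adapted_bound \<tau> x (M * K)"
  using transport_wbound[OF assms(1) _ assms(2,3)] by (simp add: adapted_bound_def mult_ac)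

lemma adapted_bound_wbound:
  assumes "0 \<le> \<tau>" "adapted_bound \<tau> x K"
  shows "wbound S d x K"
proof -
  have "wbound S d (transport S P \<tau> \<tau> x) K"
    using assms(2) unfolding adapted_bound_def by (auto dest: spec[of _ \<tau>])
  then show ?thesis
    using wbound_cong[of S "transport S P \<tau> \<tau> x" x d K] transport_initial[OF assms(1)] by blast
qed

lemma adapted_bound_transport:
  assumes times: "0 \<le> \<tau>" "\<tau> \<le> u" and x: "x summable_on states S" and K: "adapted_bound \<tau> x K"
  shows "adapted_bound u (transport S P \<tau> u x) (exp (- a * (u - \<tau>)) * K)"
  unfolding adapted_bound_def
proof (intro allI impI)
  fix t assume t: "u \<le> t"
  have "wbound S d (transport S P \<tau> t x) (exp (- a * (t - \<tau>)) * K)"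
    using K times t by (auto simp: adapted_bound_def)
  also have "exp (- a * (t - \<tau>)) = exp (- a * (t - u)) * exp (- a * (u - \<tau>))"
    by (simp add: algebra_simps flip: exp_add)
  finally show "wbound S d (transport S P u t (transport S P \<tau> u x))
      (exp (- a * (t - u)) * (exp (- a * (u - \<tau>)) * K))"
    using transport_transport[OF times t x]
    by (subst wbound_cong[where y = "transport S P \<tau> t x"]) (auto simp: mult.assoc)
qed

lemma adapted_bound_add:
  assumes \<tau>: "0 \<le> \<tau>" and x: "x summable_on states S" "adapted_bound \<tau> x K"
    and y: "y summable_on states S" "adapted_bound \<tau> y K'"
  shows "adapted_bound \<tau> (\<lambda>k. x k + y k) (K + K')"
  unfolding adapted_bound_def distrib_left
proof (intro allI impI)
  fix t assume t: "\<tau> \<le> t"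
  have "wbound S d (\<lambda>k. transport S P \<tau> t x k + transport S P \<tau> t y k)
      (exp (- a * (t - \<tau>)) * K + exp (- a * (t - \<tau>)) * K')"
    using x y t by (intro wbound_add) (auto simp: adapted_bound_def)
  then show "wbound S d (transport S P \<tau> t (\<lambda>k. x k + y k))
      (exp (- a * (t - \<tau>)) * K + exp (- a * (t - \<tau>)) * K')"
    using transport_add[OF \<tau> t x(1) y(1)]
    by (subst wbound_cong[where y = "\<lambda>k. transport S P \<tau> t x k + transport S P \<tau> t y k"]) auto
qed

text \<open>\<open>w\<close> has derivative \<open>v\<close> and satisfies the forward system up to a defect whose norm is at most
  \<open>\<Delta>\<close> times the norm of \<open>w\<close> plus \<open>c\<close>. Differences of solutions of the given and of a perturbed
  system have this form.\<close>

definition nearly_solves ::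
    "real \<Rightarrow> (real \<Rightarrow> nat \<Rightarrow> real) \<Rightarrow> (real \<Rightarrow> nat \<Rightarrow> real) \<Rightarrow> real \<Rightarrow> real \<Rightarrow> bool" where
  "nearly_solves s w v \<Delta> c \<longleftrightarrow>
     (\<forall>t\<ge>s. null_sum S (w t)) \<and>
     (\<forall>r\<ge>s. \<forall>t\<ge>r. \<forall>k\<in>states S.
        (\<lambda>u. v u k) integrable_on {r..t} \<and> w t k = w r k + integral {r..t} (\<lambda>u. v u k)) \<and>
     (AE u in lebesgue. s \<le> u \<longrightarrow> (\<forall>R. wbound S d (w u) R \<longrightarrow>
        wbound S d (\<lambda>k. v u k - (\<Sum>\<^sub>\<infinity>j\<in>states S. A_mat S q u k j * w u j)) (\<Delta> * R + c))) \<and>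
     (\<forall>T. \<exists>U. \<forall>t\<in>{s..T}. wbound S d (w t) U)"

lemma generator_wbound:
  assumes "regular_rates S q L u" "bounded_generator S d (A_mat S q u) B F"
    and "null_sum S x" "wbound S d x R"
  shows "wbound S d (\<lambda>k. \<Sum>\<^sub>\<infinity>j\<in>states S. A_mat S q u k j * x j) (B * R)"
  using assms A_mat_bounded[OF assms(1)] B_nonneg
  by (intro wbound_mat_apply) (auto simp: bounded_generator_def)

text \<open>Over a step of length \<open>h\<close>, the curve departs from the transported initial value by the
  integrated defect. Both the departure itself and the change of \<open>w\<close> are of order \<open>h\<close>, so their
  feedback into the derivative only contributes to the term with \<open>h\<^sup>2\<close>.\<close>

lemma adapted_bound_step:
  assumes w: "nearly_solves s w v \<Delta> c" and s: "0 \<le> s" and r: "s \<le> r" and h: "0 \<le> h"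
    and \<Delta>: "0 \<le> \<Delta>" and c: "0 \<le> c"
    and U: "\<And>u. u \<in> {r..r + h} \<Longrightarrow> wbound S d (w u) U"
    and Y: "adapted_bound r (w r) Y"
    and C: "C = B * (B * (U + M * U) + (\<Delta> * U + c)) + \<Delta> * (B * U + (\<Delta> * U + c))"
  shows "adapted_bound (r + h) (w (r + h))
    (exp (- a * h) * Y + M * ((\<Delta> * Y + c) * h + C * h\<^sup>2))"
proof -
  \<comment> \<open>\<open>x\<close> is the departure of \<open>w\<close> from the solution \<open>T\<close> that starts at the same point. \<open>D\<^sub>1\<close> and \<open>D\<^sub>2\<close>
    are crude bounds for the derivatives of \<open>x\<close> and \<open>w\<close> on the step.\<close>
  define T where "T \<equiv> \<lambda>u. transport S P r u (w r)"
  define x where "x \<equiv> \<lambda>u k. w u k - T u k"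
  define v' where "v' \<equiv> \<lambda>u k. v u k - (\<Sum>\<^sub>\<infinity>j\<in>states S. A_mat S q u k j * T u j)"
  define D\<^sub>1 where "D\<^sub>1 = B * (U + M * U) + (\<Delta> * U + c)"
  define D\<^sub>2 where "D\<^sub>2 = B * U + (\<Delta> * U + c)"
  have r0: "0 \<le> r" using s r by simp
  have U0: "0 \<le> U" using U[of r] h wbound_nonneg by force
  have null: "null_sum S (w u)" if "r \<le> u" for u
    using w r that by (auto simp: nearly_solves_def)
  have sm: "w r summable_on states S"
    using null[OF order_refl] by (rule has_sum_imp_summable)
  have wi: "(\<lambda>u. v u k) integrable_on {r..t}" "w t k = w r k + integral {r..t} (\<lambda>u. v u k)"
    if "k \<in> states S" "r \<le> t" for k t
    using w r that unfolding nearly_solves_def by blast+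
  have nullT: "null_sum S (T u)" if "r \<le> u" for u
    unfolding T_def by (rule transport_has_sum[OF r0 that null[OF order_refl]])
  have nullx: "null_sum S (x u)" if "r \<le> u" for u
    unfolding x_def using has_sum_diff_real[OF null[OF that] nullT[OF that]] by simp
  have Tb: "wbound S d (T u) (M * U)" if "u \<in> {r..r + h}" for u
  proof -
    have "wbound S d (T u) (M * exp (- a * (u - r)) * U)"
      unfolding T_def using that U[of r] h null[of r] r0 by (intro transport_wbound) auto
    moreover have "M * exp (- a * (u - r)) * U \<le> M * 1 * U"
      using M_pos a_pos U0 that by (intro mult_right_mono mult_left_mono) auto
    ultimately show ?thesis by (metis mult.right_neutral wbound_mono)
  qed
  have xi: "(\<lambda>u. v' u k) integrable_on {r..t}" "x t k = x r k + integral {r..t} (\<lambda>u. v' u k)"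
    if k: "k \<in> states S" and t: "r \<le> t" for k t
  proof -
    note T' = transport_solves[OF r0 t sm k]
    show "(\<lambda>u. v' u k) integrable_on {r..t}"
      unfolding v'_def T_def using wi(1)[OF k t] T'(1) by (rule integrable_diff)
    show "x t k = x r k + integral {r..t} (\<lambda>u. v' u k)"
      unfolding x_def v'_def T_def integral_diff[OF wi(1)[OF k t] T'(1)]
      using wi(2)[OF k t] T'(2) transport_initial[OF r0 k] by simp
  qed
  have x0: "wbound S d (x r) 0"
    using transport_initial[OF r0]
    by (subst wbound_cong[where y = "\<lambda>k. 0"]) (auto simp: x_def T_def wbound_def cum_def)
  have deriv: "AE u in lebesgue. u \<in> {r..r + h} \<longrightarrow>
      (\<forall>R R'. wbound S d (x u) R \<and> wbound S d (w u) R' \<longrightarrow>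
        wbound S d (v' u) (B * R + (\<Delta> * R' + c)) \<and> wbound S d (v u) (B * R' + (\<Delta> * R' + c)))"
  proof -
    have "AE u in lebesgue. s \<le> u \<longrightarrow> (\<forall>R. wbound S d (w u) R \<longrightarrow>
        wbound S d (\<lambda>k. v u k - (\<Sum>\<^sub>\<infinity>j\<in>states S. A_mat S q u k j * w u j)) (\<Delta> * R + c))"
      using w by (simp add: nearly_solves_def)
    with AE_generator show ?thesis
    proof eventually_elim
      case (elim u)
      show ?case
      proof (intro impI allI, elim conjE)
        fix R R' assume u: "u \<in> {r..r + h}" and R: "wbound S d (x u) R" and R': "wbound S d (w u) R'"
        let ?A = "\<lambda>y k. \<Sum>\<^sub>\<infinity>j\<in>states S. A_mat S q u k j * y j"
        have reg: "regular_rates S q L u" and gen: "bounded_generator S d (A_mat S q u) B F"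
          and def: "wbound S d (\<lambda>k. v u k - ?A (w u) k) (\<Delta> * R' + c)"
          using elim u r s R' by auto
        have ru: "r \<le> u" using u by simp
        have lin: "?A (x u) k = ?A (w u) k - ?A (T u) k" if k: "k \<in> states S" for k
        proof -
          have "(\<lambda>j. A_mat S q u k j * y j) summable_on states S" if "null_sum S y" for y
            using has_sum_imp_summable[OF that] A_mat_bounded[OF reg k]
            by (rule summable_on_bounded_mult)
          from has_sum_diff_real[OF has_sum_infsum[OF this[OF null[OF ru]]]
              has_sum_infsum[OF this[OF nullT[OF ru]]]]
          show ?thesis unfolding x_def right_diff_distrib by (rule infsumI)
        qed
        have "wbound S d (\<lambda>k. ?A (x u) k + (v u k - ?A (w u) k)) (B * R + (\<Delta> * R' + c))"
          by (intro wbound_add def generator_wbound[OF reg gen nullx[OF ru] R])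
        moreover have "wbound S d (\<lambda>k. ?A (w u) k + (v u k - ?A (w u) k)) (B * R' + (\<Delta> * R' + c))"
          by (intro wbound_add def generator_wbound[OF reg gen null[OF ru] R'])
        ultimately show "wbound S d (v' u) (B * R + (\<Delta> * R' + c)) \<and> wbound S d (v u) (B * R' + (\<Delta> * R' + c))"
          using wbound_cong[of S "\<lambda>k. ?A (x u) k + (v u k - ?A (w u) k)" "v' u"] lin
          by (simp add: v'_def)
      qed
    qed
  qed
  have x1: "wbound S d (x u) (D\<^sub>1 * h)" if u: "u \<in> {r..r + h}" for u
  proof -
    have "wbound S d (x u) (0 + D\<^sub>1 * (u - r))"
    proof (rule wbound_evolution[where s = r and t = u and x = x and v = v', OF _ xi])
      have xU: "wbound S d (x u) (U + M * U)" if "u \<in> {r..r + h}" for u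
        unfolding x_def by (rule wbound_diff[OF U[OF that] Tb[OF that]])
      show "AE u' in lebesgue. u' \<in> {r..u} \<longrightarrow> wbound S d (v' u') D\<^sub>1"
        using deriv unfolding D\<^sub>1_def
      proof eventually_elim
        case (elim u')
        show ?case
        proof
          assume "u' \<in> {r..u}"
          then have u': "u' \<in> {r..r + h}" using u by auto
          from elim u' U[OF u'] xU[OF u']
          show "wbound S d (v' u') (B * (U + M * U) + (\<Delta> * U + c))" by blast
        qed
      qed
    qed (use u x0 in auto)
    moreover have "0 \<le> D\<^sub>1"
      unfolding D\<^sub>1_def using B_nonneg U0 M_pos \<Delta> c by simp
    then have "D\<^sub>1 * (u - r) \<le> D\<^sub>1 * h" using u by (intro mult_left_mono) auto
    ultimately show ?thesis by (auto intro: wbound_mono)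
  qed
  have w1: "wbound S d (w u) (Y + D\<^sub>2 * h)" if u: "u \<in> {r..r + h}" for u
  proof -
    have "wbound S d (w u) (Y + D\<^sub>2 * (u - r))"
    proof (rule wbound_evolution[where s = r and t = u and x = w and v = v, OF _ wi])
      show "AE u' in lebesgue. u' \<in> {r..u} \<longrightarrow> wbound S d (v u') D\<^sub>2"
        using deriv unfolding D\<^sub>2_def
      proof eventually_elim
        case (elim u')
        show ?case
        proof
          assume "u' \<in> {r..u}"
          then have u': "u' \<in> {r..r + h}" using u by auto
          from elim u' U[OF u'] x1[OF u'] show "wbound S d (v u') (B * U + (\<Delta> * U + c))" by blast
        qed
      qed
      show "wbound S d (w r) Y" by (rule adapted_bound_wbound[OF r0 Y])
    qed (use u in auto)
    moreover have "0 \<le> D\<^sub>2"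
      unfolding D\<^sub>2_def using B_nonneg U0 M_pos \<Delta> c by simp
    then have "D\<^sub>2 * (u - r) \<le> D\<^sub>2 * h" using u by (intro mult_left_mono) auto
    ultimately show ?thesis by (auto intro: wbound_mono)
  qed
  let ?t = "r + h"
  have "wbound S d (x ?t) (0 + (B * (D\<^sub>1 * h) + (\<Delta> * (Y + D\<^sub>2 * h) + c)) * (?t - r))"
  proof (rule wbound_evolution[where s = r and t = "r + h" and x = x and v = v', OF _ xi _ x0])
    show "AE u in lebesgue. u \<in> {r..r + h} \<longrightarrow>
        wbound S d (v' u) (B * (D\<^sub>1 * h) + (\<Delta> * (Y + D\<^sub>2 * h) + c))"
      using deriv by eventually_elim (use x1 w1 in blast)
  qed (use h in auto)
  also have "0 + (B * (D\<^sub>1 * h) + (\<Delta> * (Y + D\<^sub>2 * h) + c)) * (?t - r) = (\<Delta> * Y + c) * h + C * h\<^sup>2"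
    by (simp add: C D\<^sub>1_def D\<^sub>2_def power2_eq_square algebra_simps)
  finally have "adapted_bound ?t (x ?t) (M * ((\<Delta> * Y + c) * h + C * h\<^sup>2))"
    using r0 h nullx[of ?t] by (intro adapted_boundI) auto
  moreover have "adapted_bound ?t (T ?t) (exp (- a * h) * Y)"
    using adapted_bound_transport[OF r0 _ sm Y, of ?t] h by (simp add: T_def)
  ultimately have "adapted_bound ?t (\<lambda>k. T ?t k + x ?t k)
      (exp (- a * h) * Y + M * ((\<Delta> * Y + c) * h + C * h\<^sup>2))"
    using r0 h nullx[of ?t] nullT[of ?t] by (intro adapted_bound_add) (auto dest: has_sum_imp_summable)
  then show ?thesis
    by (simp add: x_def)
qed

text \<open>With \<open>n\<close> steps of length \<open>h = (t - s) / n\<close>, the adapted bounds satisfy an affine recursion with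
  factor \<open>\<rho> = exp (- a h) + M \<Delta> h\<close> and increment \<open>\<beta> = M (c h + C h\<^sup>2)\<close>. As \<open>n\<close> grows, \<open>\<rho>\<^sup>n\<close> tends to
  \<open>exp (- (a - M \<Delta>) (t - s))\<close>, and \<open>\<beta> / (1 - \<rho>)\<close> to \<open>M c / (a - M \<Delta>)\<close>. This discrete variation of
  constants replaces the differentiation of \<open>transport\<close> in its initial time.\<close>

lemma nearly_solves_decay:
  assumes w: "nearly_solves s w v \<Delta> c" and s: "0 \<le> s" "s \<le> t"
    and \<Delta>: "0 \<le> \<Delta>" "M * \<Delta> < a" and c: "0 \<le> c" and R: "wbound S d (w s) R"
  shows "wbound S d (w t) (M * exp (- (a - M * \<Delta>) * (t - s)) * R + M * c / (a - M * \<Delta>))"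
proof (cases "t = s")
  case True
  have "null_sum S (w s)" using w by (simp add: nearly_solves_def)
  from adapted_bound_wbound[OF s(1) adapted_boundI[OF s(1) this R]] show ?thesis
    using True \<Delta> c M_pos by (auto intro: wbound_mono)
next
  case False
  define T where "T = t - s"
  have T: "0 < T" using False s by (simp add: T_def)
  obtain U where U: "\<And>u. u \<in> {s..t} \<Longrightarrow> wbound S d (w u) U"
    using w unfolding nearly_solves_def by blast
  define C where "C = B * (B * (U + M * U) + (\<Delta> * U + c)) + \<Delta> * (B * U + (\<Delta> * U + c))"
  define b where "b = a - M * \<Delta>"
  have b: "0 < b" using \<Delta> by (simp add: b_def)
  define \<rho> where "\<rho> \<equiv> \<lambda>n. exp (- (a * (T / real n))) + M * \<Delta> * (T / real n)"
  define \<beta> where "\<beta> \<equiv> \<lambda>n. M * (c * (T / real n) + C * (T / real n)\<^sup>2)"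
  have R0: "0 \<le> R" and U0: "0 \<le> U" using wbound_nonneg[OF R] wbound_nonneg[OF U[of s]] s by auto
  have C0: "0 \<le> C" using B_nonneg U0 M_pos \<Delta> c by (simp add: C_def)
  have iter: "adapted_bound (s + real i * (T / real n)) (w (s + real i * (T / real n)))
      (\<rho> n ^ i * (M * R) + \<beta> n * (\<Sum>l<i. \<rho> n ^ l))" if n: "0 < n" and "i \<le> n" for n i
    using \<open>i \<le> n\<close>
  proof (induction i)
    case 0
    have "null_sum S (w s)" using w by (simp add: nearly_solves_def)
    from adapted_boundI[OF s(1) this R] show ?case by simp
  next
    case (Suc i)
    define h where "h = T / real n"
    define r where "r = s + real i * h"
    define Y where "Y = \<rho> n ^ i * (M * R) + \<beta> n * (\<Sum>l<i. \<rho> n ^ l)"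
    have h: "0 \<le> h" using T by (simp add: h_def)
    have r: "s \<le> r" using h by (simp add: r_def)
    have "real (Suc i) * h \<le> real n * h"
      using Suc.prems h by (intro mult_right_mono) auto
    also have "\<dots> = T" using n by (simp add: h_def)
    finally have rt: "r + h \<le> t" by (simp add: r_def T_def algebra_simps)
    have "adapted_bound r (w r) Y"
      using Suc by (simp add: r_def Y_def h_def)
    then have "adapted_bound (r + h) (w (r + h))
        (exp (- a * h) * Y + M * ((\<Delta> * Y + c) * h + C * h\<^sup>2))"
      using U r rt by (intro adapted_bound_step[OF w s(1) r h \<Delta>(1) c _ _ C_def]) auto
    also have "r + h = s + real (Suc i) * h"
      by (simp add: r_def algebra_simps)
    also have "exp (- a * h) * Y + M * ((\<Delta> * Y + c) * h + C * h\<^sup>2) = \<rho> n * Y + \<beta> n"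
      by (simp add: \<rho>_def \<beta>_def h_def algebra_simps)
    also have "\<rho> n * Y + \<beta> n = \<rho> n ^ Suc i * (M * R) + \<beta> n * (\<Sum>l<Suc i. \<rho> n ^ l)"
      unfolding Y_def sum.lessThan_Suc_shift by (simp add: algebra_simps sum_distrib_left)
    finally show ?case by (simp add: h_def)
  qed
  have \<rho>0: "0 \<le> \<rho> n" for n using M_pos \<Delta> T by (simp add: \<rho>_def)
  have \<beta>0: "0 \<le> \<beta> n" for n using M_pos C0 c T by (simp add: \<beta>_def)
  have step: "wbound S d (w t) (\<rho> n ^ n * (M * R) + \<beta> n / (1 - \<rho> n))" if n: "0 < n" and \<rho>1: "\<rho> n < 1" for n
  proof -
    have "s + real n * (T / real n) = t" using n by (simp add: T_def)
    with iter[OF n order_refl]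
    have "wbound S d (w t) (\<rho> n ^ n * (M * R) + \<beta> n * (\<Sum>l<n. \<rho> n ^ l))"
      using s by (intro adapted_bound_wbound[of t]) auto
    moreover have "(\<Sum>l<n. \<rho> n ^ l) \<le> 1 / (1 - \<rho> n)"
      using \<rho>0[of n] \<rho>1 by (simp add: sum_gp_strict divide_right_mono)
    then have "\<beta> n * (\<Sum>l<n. \<rho> n ^ l) \<le> \<beta> n / (1 - \<rho> n)"
      using mult_left_mono[OF _ \<beta>0] by fastforce
    ultimately show ?thesis by (auto intro: wbound_mono)
  qed
  have ev: "\<forall>\<^sub>F n in sequentially. 0 < n \<and> \<rho> n < 1"
  proof -
    \<comment> \<open>In terms of \<open>b\<close> and \<open>g\<close>, the sign of the leading coefficient in \<open>T / n\<close> is visible.\<close>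
    define g where "g = M * \<Delta>"
    have "a = b + g" by (simp add: b_def g_def)
    have "\<forall>\<^sub>F n in sequentially. exp (- ((b + g) * (T / real n))) + g * (T / real n) < 1"
      using b T by real_asymp
    then show ?thesis
      unfolding \<rho>_def g_def[symmetric] \<open>a = b + g\<close>
      using eventually_gt_at_top[of 0] by eventually_elim auto
  qed
  have lim: "(\<lambda>n. \<rho> n ^ n * (M * R) + \<beta> n / (1 - \<rho> n)) \<longlonglongrightarrow> exp (- b * T) * (M * R) + M * c / b"
  proof (intro tendsto_add tendsto_mult_right)
    define g where "g = M * \<Delta>"
    have a: "a = b + g" by (simp add: b_def g_def)
    have "(\<lambda>n. (exp (- ((b + g) * (T / real n))) + g * (T / real n)) ^ n)
        \<longlonglongrightarrow> exp (g * T - (b + g) * T)"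
      using b T by real_asymp
    also have "g * T - (b + g) * T = - b * T" by (simp add: algebra_simps)
    finally have "(\<lambda>n. (exp (- ((b + g) * (T / real n))) + g * (T / real n)) ^ n) \<longlonglongrightarrow> exp (- b * T)" .
    then show "(\<lambda>n. \<rho> n ^ n) \<longlonglongrightarrow> exp (- b * T)"
      by (simp add: \<rho>_def g_def[symmetric] a)
    have "(\<lambda>n. (c * (T / real n) + C * (T / real n)\<^sup>2) /
        (1 - (exp (- ((b + g) * (T / real n))) + g * (T / real n)))) \<longlonglongrightarrow> c * T * inverse ((b + g) * T - g * T)"
      using b T by real_asymp
    also have "c * T * inverse ((b + g) * T - g * T) = c / b"
      using b T by (simp add: field_simps)
    finally have "(\<lambda>n. (c * (T / real n) + C * (T / real n)\<^sup>2) /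
        (1 - (exp (- ((b + g) * (T / real n))) + g * (T / real n)))) \<longlonglongrightarrow> c / b" .
    from tendsto_mult_left[OF this, of M] show "(\<lambda>n. \<beta> n / (1 - \<rho> n)) \<longlonglongrightarrow> M * c / b"
      by (simp add: \<rho>_def \<beta>_def g_def[symmetric] a)
  qed
  have "wbound S d (w t) (exp (- b * T) * (M * R) + M * c / b)"
    unfolding wbound_def
  proof (intro allI impI)
    fix J assume J: "finite J" "J \<subseteq> pos_states S"
    have "\<forall>\<^sub>F n in sequentially. (\<Sum>i\<in>J. d i * \<bar>cum (w t) i\<bar>) \<le> \<rho> n ^ n * (M * R) + \<beta> n / (1 - \<rho> n)"
      using ev by eventually_elim (use wboundD[OF step J] in blast)
    with lim show "(\<Sum>i\<in>J. d i * \<bar>cum (w t) i\<bar>) \<le> exp (- b * T) * (M * R) + M * c / b"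
      by (rule tendsto_lowerbound) simp
  qed
  then show ?thesis by (simp add: b_def T_def mult_ac)
qed

end

section \<open>Solutions of the unperturbed and of the perturbed system\<close>

context ergodic_chain
begin

text \<open>The constant curve at the unit vector of state \<open>0\<close> is compared with the solution. Its defect is
  column \<open>0\<close> of the generator, that is, the inhomogeneity of the reduced system.\<close>

lemma solution_bound:
  assumes s: "0 \<le> s" "s \<le> t" and p: "state_probabilities S q s p"
    and R: "wbound S d (\<lambda>k. p s k - origin k) R"
  shows "wbound S d (\<lambda>k. p t k - origin k) (M * exp (- a * (t - s)) * R + M * F / a)"
proof -
  define v where "v \<equiv> \<lambda>u k. \<Sum>\<^sub>\<infinity>j\<in>states S. A_mat S q u k j * p u j"
  have prob: "prob_vec S (p u)" if "s \<le> u" for u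
    using p that by (simp add: state_probabilities_def)
  have l1: "p s \<in> l1D S d" using l1D_iff[OF prob[OF order_refl]] R by blast
  have "nearly_solves s (\<lambda>t k. p t k - origin k) v 0 F"
    unfolding nearly_solves_def
  proof (intro conjI allI impI ballI)
    fix r t k assume rt: "s \<le> r" "r \<le> t" and k: "k \<in> states S"
    note i = state_probabilities_integral[OF state_probabilities_restart[OF p rt(1)] k rt(2)]
    show "(\<lambda>u. v u k) integrable_on {r..t}" unfolding v_def by (rule i(1))
    show "p t k - origin k = p r k - origin k + integral {r..t} (\<lambda>u. v u k)"
      unfolding v_def using i(2) by linarith
  next
    show "AE u in lebesgue. s \<le> u \<longrightarrow> (\<forall>R. wbound S d (\<lambda>k. p u k - origin k) R \<longrightarrow>
        wbound S d (\<lambda>k. v u k - (\<Sum>\<^sub>\<infinity>j\<in>states S. A_mat S q u k j * (p u j - origin j))) (0 * R + F))"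
      using AE_generator
    proof eventually_elim
      case (elim u)
      show ?case
      proof (intro impI allI)
        fix R assume u: "s \<le> u"
        then have reg: "regular_rates S q L u" and gen: "bounded_generator S d (A_mat S q u) B F"
          using elim s by auto
        show "wbound S d (\<lambda>k. v u k - (\<Sum>\<^sub>\<infinity>j\<in>states S. A_mat S q u k j * (p u j - origin j))) (0 * R + F)"
          using generator_apply_origin[OF reg _ prob[OF u]] gen
          by (subst wbound_cong[where y = "\<lambda>k. A_mat S q u k 0"])
            (auto simp: v_def bounded_generator_def)
      qed
    qed
  next
    fix T show "\<exists>U. \<forall>t\<in>{s..T}. wbound S d (\<lambda>k. p t k - origin k) U"
      by (rule solution_locally_bounded[OF s(1) p l1])
  qed (use prob prob_minus_origin in auto)
  from nearly_solves_decay[OF this s _ _ F_nonneg R] show ?thesis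
    using a_pos by simp
qed

end

locale perturbed_chain = ergodic_chain S q L P Q X d B F M a
  for S q L P Q X d B F M a +
  fixes q' :: "nat \<Rightarrow> nat \<Rightarrow> real \<Rightarrow> real" and L' \<Delta>B \<Delta>f :: real
  assumes regular': "AE u in lebesgue. 0 \<le> u \<longrightarrow> regular_rates S q' L' u"
    and perturbation: "AE u in lebesgue. 0 \<le> u \<longrightarrow>
      bounded_generator S d (\<lambda>k j. A_mat S q u k j - A_mat S q' u k j) \<Delta>B \<Delta>f"
    and \<Delta>B_nonneg: "0 \<le> \<Delta>B" and \<Delta>f_nonneg: "0 \<le> \<Delta>f"
    and small: "M * \<Delta>B < a"
begin

lemma AE_perturbation: "AE u in lebesgue. 0 \<le> u \<longrightarrow>
    regular_rates S q L u \<and> regular_rates S q' L' u \<and>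
    bounded_generator S d (\<lambda>k j. A_mat S q u k j - A_mat S q' u k j) \<Delta>B \<Delta>f"
  using AE_regular_rates regular' perturbation by eventually_elim auto

lemma perturbed_bounded_generator:
  "AE u in lebesgue. 0 \<le> u \<longrightarrow> bounded_generator S d (A_mat S q' u) (B + \<Delta>B) (F + \<Delta>f)"
  using AE_generator AE_perturbation
proof eventually_elim
  case (elim u)
  show ?case
  proof
    assume "0 \<le> u"
    with elim have "bounded_generator S d
        (\<lambda>k j. A_mat S q u k j - (A_mat S q u k j - A_mat S q' u k j)) (B + \<Delta>B) (F + \<Delta>f)"
      by (intro bounded_generator_diff) auto
    then show "bounded_generator S d (A_mat S q' u) (B + \<Delta>B) (F + \<Delta>f)" by simp
  qed
qed

lemma difference_wbound:
  assumes reg: "regular_rates S q L u" "regular_rates S q' L' u"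
    and gen: "bounded_generator S d (\<lambda>k j. A_mat S q u k j - A_mat S q' u k j) \<Delta>B \<Delta>f"
    and x: "null_sum S x" and R: "wbound S d x R"
  shows "wbound S d (\<lambda>k. (\<Sum>\<^sub>\<infinity>j\<in>states S. A_mat S q u k j * x j)
    - (\<Sum>\<^sub>\<infinity>j\<in>states S. A_mat S q' u k j * x j)) (\<Delta>B * R)"
proof -
  let ?m = "\<lambda>k j. A_mat S q u k j - A_mat S q' u k j"
  have "\<bar>?m k j\<bar> \<le> L + L'" if "k \<in> states S" "j \<in> states S" for k j
    using A_mat_bounded[OF reg(1) that] A_mat_bounded[OF reg(2) that] by linarith
  then have "wbound S d (\<lambda>k. \<Sum>\<^sub>\<infinity>j\<in>states S. ?m k j * x j) (\<Delta>B * R)"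
    using gen x R \<Delta>B_nonneg by (intro wbound_mat_apply) (auto simp: bounded_generator_def)
  moreover have "(\<Sum>\<^sub>\<infinity>j\<in>states S. ?m k j * x j) = (\<Sum>\<^sub>\<infinity>j\<in>states S. A_mat S q u k j * x j)
      - (\<Sum>\<^sub>\<infinity>j\<in>states S. A_mat S q' u k j * x j)" if k: "k \<in> states S" for k
    using A_mat_bounded[OF reg(1) k] A_mat_bounded[OF reg(2) k] has_sum_imp_summable[OF x]
    by (rule apply_diff_mat)
  ultimately show ?thesis
    by (subst wbound_cong[where y = "\<lambda>k. \<Sum>\<^sub>\<infinity>j\<in>states S. ?m k j * x j"]) auto
qed

text \<open>The difference of two solutions of the perturbed system solves the original system up to a
  defect of relative size \<open>\<Delta>B\<close>.\<close>

lemma perturbed_difference_decay: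
  assumes s: "0 \<le> s" "s \<le> t"
    and p: "state_probabilities S q' s p" and p': "state_probabilities S q' s p'"
    and bd: "\<And>T. \<exists>U. \<forall>t\<in>{s..T}. wbound S d (\<lambda>k. p t k - origin k) U"
      "\<And>T. \<exists>U. \<forall>t\<in>{s..T}. wbound S d (\<lambda>k. p' t k - origin k) U"
    and R: "wbound S d (\<lambda>k. p s k - p' s k) R"
  shows "wbound S d (\<lambda>k. p t k - p' t k) (M * exp (- (a - M * \<Delta>B) * (t - s)) * R)"
proof -
  define y where "y \<equiv> \<lambda>p u k. \<Sum>\<^sub>\<infinity>j\<in>states S. A_mat S q' u k j * p u j"
  have prob: "prob_vec S (p u)" "prob_vec S (p' u)" if "s \<le> u" for u
    using p p' that by (auto simp: state_probabilities_def)
  have "nearly_solves s (\<lambda>t k. p t k - p' t k) (\<lambda>u k. y p u k - y p' u k) \<Delta>B 0"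
    unfolding nearly_solves_def
  proof (intro conjI allI impI ballI)
    fix r t k assume rt: "s \<le> r" "r \<le> t" and k: "k \<in> states S"
    note i = state_probabilities_integral[OF state_probabilities_restart[OF p rt(1)] k rt(2)]
      and i' = state_probabilities_integral[OF state_probabilities_restart[OF p' rt(1)] k rt(2)]
    show "(\<lambda>u. y p u k - y p' u k) integrable_on {r..t}"
      unfolding y_def using i(1) i'(1) by (rule integrable_diff)
    show "p t k - p' t k = p r k - p' r k + integral {r..t} (\<lambda>u. y p u k - y p' u k)"
      unfolding y_def integral_diff[OF i(1) i'(1)] using i(2) i'(2) by linarith
  next
    show "AE u in lebesgue. s \<le> u \<longrightarrow> (\<forall>R. wbound S d (\<lambda>k. p u k - p' u k) R \<longrightarrow>
        wbound S d (\<lambda>k. y p u k - y p' u k -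
          (\<Sum>\<^sub>\<infinity>j\<in>states S. A_mat S q u k j * (p u j - p' u j))) (\<Delta>B * R + 0))"
      using AE_perturbation
    proof eventually_elim
      case (elim u)
      show ?case
      proof (intro impI allI)
        fix R assume u: "s \<le> u" and R: "wbound S d (\<lambda>k. p u k - p' u k) R"
        then have reg: "regular_rates S q L u" "regular_rates S q' L' u"
          and gen: "bounded_generator S d (\<lambda>k j. A_mat S q u k j - A_mat S q' u k j) \<Delta>B \<Delta>f"
          using elim s by auto
        note null = prob_diff[OF prob[OF u]]
        have sm: "p u summable_on states S" "p' u summable_on states S"
          using prob[OF u] by (auto simp: prob_vec_def summable_on_def)
        have "y p u k - y p' u k = (\<Sum>\<^sub>\<infinity>j\<in>states S. A_mat S q' u k j * (p u j - p' u j))"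
          if k: "k \<in> states S" for k
          unfolding y_def using A_mat_bounded[OF reg(2) k] sm by (rule apply_diff_vec[symmetric])
        then show "wbound S d (\<lambda>k. y p u k - y p' u k -
            (\<Sum>\<^sub>\<infinity>j\<in>states S. A_mat S q u k j * (p u j - p' u j))) (\<Delta>B * R + 0)"
          using wbound_minus[OF difference_wbound[OF reg gen null R]]
          by (subst wbound_cong[where y = "\<lambda>k. - ((\<Sum>\<^sub>\<infinity>j\<in>states S. A_mat S q u k j * (p u j - p' u j))
            - (\<Sum>\<^sub>\<infinity>j\<in>states S. A_mat S q' u k j * (p u j - p' u j)))"]) auto
      qed
    qed
  next
    fix T
    from bd[of T] obtain U U' where
      "\<forall>t\<in>{s..T}. wbound S d (\<lambda>k. p t k - origin k) U" "\<forall>t\<in>{s..T}. wbound S d (\<lambda>k. p' t k - origin k) U'"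
      by blast
    then have "\<forall>t\<in>{s..T}. wbound S d (\<lambda>k. (p t k - origin k) - (p' t k - origin k)) (U + U')"
      using wbound_diff by blast
    then show "\<exists>U. \<forall>t\<in>{s..T}. wbound S d (\<lambda>k. p t k - p' t k) U" by auto
  qed (use prob prob_diff in auto)
  from nearly_solves_decay[OF this s \<Delta>B_nonneg small order_refl R] show ?thesis by simp
qed

text \<open>For a solution of each system the defect also involves the solution itself, through the
  estimate \<open>\<parallel>p'\<parallel> \<le> \<parallel>p\<parallel> + \<parallel>p - p'\<parallel>\<close>. The second summand has the relative size \<open>\<Delta>B\<close>, the first one is
  bounded from time \<open>s\<close> on.\<close>

lemma solution_perturbed_solution:
  assumes s: "0 \<le> s" "s \<le> t"
    and p: "state_probabilities S q s p" and p': "state_probabilities S q' s p'"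
    and bd: "\<And>T. \<exists>U. \<forall>t\<in>{s..T}. wbound S d (\<lambda>k. p' t k - origin k) U"
    and K: "\<And>t. s \<le> t \<Longrightarrow> wbound S d (\<lambda>k. p t k - origin k) K"
    and R: "wbound S d (\<lambda>k. p s k - p' s k) R"
  shows "wbound S d (\<lambda>k. p t k - p' t k)
    (M * exp (- (a - M * \<Delta>B) * (t - s)) * R + M * (\<Delta>B * K + \<Delta>f) / (a - M * \<Delta>B))"
proof -
  define y where "y \<equiv> \<lambda>u k. \<Sum>\<^sub>\<infinity>j\<in>states S. A_mat S q u k j * p u j"
  define y' where "y' \<equiv> \<lambda>u k. \<Sum>\<^sub>\<infinity>j\<in>states S. A_mat S q' u k j * p' u j"
  have prob: "prob_vec S (p u)" "prob_vec S (p' u)" if "s \<le> u" for u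
    using p p' that by (auto simp: state_probabilities_def)
  have K0: "0 \<le> K" using wbound_nonneg[OF K[OF order_refl]] .
  have "nearly_solves s (\<lambda>t k. p t k - p' t k) (\<lambda>u k. y u k - y' u k) \<Delta>B (\<Delta>B * K + \<Delta>f)"
    unfolding nearly_solves_def
  proof (intro conjI allI impI ballI)
    fix r t k assume rt: "s \<le> r" "r \<le> t" and k: "k \<in> states S"
    note i = state_probabilities_integral[OF state_probabilities_restart[OF p rt(1)] k rt(2)]
      and i' = state_probabilities_integral[OF state_probabilities_restart[OF p' rt(1)] k rt(2)]
    show "(\<lambda>u. y u k - y' u k) integrable_on {r..t}"
      unfolding y_def y'_def using i(1) i'(1) by (rule integrable_diff)
    show "p t k - p' t k = p r k - p' r k + integral {r..t} (\<lambda>u. y u k - y' u k)"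
      unfolding y_def y'_def integral_diff[OF i(1) i'(1)] using i(2) i'(2) by linarith
  next
    show "AE u in lebesgue. s \<le> u \<longrightarrow> (\<forall>R. wbound S d (\<lambda>k. p u k - p' u k) R \<longrightarrow>
        wbound S d (\<lambda>k. y u k - y' u k -
          (\<Sum>\<^sub>\<infinity>j\<in>states S. A_mat S q u k j * (p u j - p' u j))) (\<Delta>B * R + (\<Delta>B * K + \<Delta>f)))"
      using AE_perturbation
    proof eventually_elim
      case (elim u)
      show ?case
      proof (intro impI allI)
        fix R assume u: "s \<le> u" and R: "wbound S d (\<lambda>k. p u k - p' u k) R"
        then have reg: "regular_rates S q L u" "regular_rates S q' L' u"
          and gen: "bounded_generator S d (\<lambda>k j. A_mat S q u k j - A_mat S q' u k j) \<Delta>B \<Delta>f"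
          using elim s by auto
        let ?A = "\<lambda>q x k. \<Sum>\<^sub>\<infinity>j\<in>states S. A_mat S q u k j * x j"
        let ?x = "\<lambda>j. p' u j - origin j"
        have sm: "p u summable_on states S" "p' u summable_on states S"
          using prob[OF u] by (auto simp: prob_vec_def summable_on_def)
        have "wbound S d (\<lambda>k. (p u k - origin k) - (p u k - p' u k)) (K + R)"
          by (rule wbound_diff[OF K[OF u] R])
        then have x: "wbound S d ?x (K + R)" by simp
        have "wbound S d (\<lambda>k. (?A q ?x k - ?A q' ?x k) + (A_mat S q u k 0 - A_mat S q' u k 0))
            (\<Delta>B * (K + R) + \<Delta>f)"
          using gen difference_wbound[OF reg gen prob_minus_origin[OF prob(2)[OF u]] x]
          by (intro wbound_add) (auto simp: bounded_generator_def)
        moreover have "y u k - y' u k - ?A q (\<lambda>j. p u j - p' u j) k =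
            (?A q ?x k - ?A q' ?x k) + (A_mat S q u k 0 - A_mat S q' u k 0)" if k: "k \<in> states S" for k
        proof -
          have "?A q (\<lambda>j. p u j - p' u j) k = ?A q (p u) k - ?A q (p' u) k"
            using A_mat_bounded[OF reg(1) k] sm by (rule apply_diff_vec)
          moreover have "?A q (p' u) k = ?A q ?x k + A_mat S q u k 0"
            by (rule generator_apply_origin[OF reg(1) k prob(2)[OF u]])
          moreover have "?A q' (p' u) k = ?A q' ?x k + A_mat S q' u k 0"
            by (rule generator_apply_origin[OF reg(2) k prob(2)[OF u]])
          ultimately show ?thesis by (simp add: y_def y'_def)
        qed
        ultimately show "wbound S d (\<lambda>k. y u k - y' u k - ?A q (\<lambda>j. p u j - p' u j) k)
            (\<Delta>B * R + (\<Delta>B * K + \<Delta>f))"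
          by (subst wbound_cong[where y = "\<lambda>k. (?A q ?x k - ?A q' ?x k) +
              (A_mat S q u k 0 - A_mat S q' u k 0)"]) (auto simp: algebra_simps)
      qed
    qed
  next
    fix T
    from bd[of T] obtain U where "\<forall>t\<in>{s..T}. wbound S d (\<lambda>k. p' t k - origin k) U" by blast
    then have "\<forall>t\<in>{s..T}. wbound S d (\<lambda>k. (p t k - origin k) - (p' t k - origin k)) (K + U)"
      using wbound_diff K by (metis atLeastAtMost_iff)
    then show "\<exists>U. \<forall>t\<in>{s..T}. wbound S d (\<lambda>k. p t k - p' t k) U" by auto
  qed (use prob prob_diff in auto)
  moreover have "0 \<le> \<Delta>B * K + \<Delta>f" using \<Delta>B_nonneg \<Delta>f_nonneg K0 by simp
  ultimately show ?thesis
    using R by (rule nearly_solves_decay[OF _ s \<Delta>B_nonneg small])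
qed

end

context perturbed_chain
begin

text \<open>Restarting the comparison at a late time \<open>s\<close> lowers the bound for \<open>p\<close> to nearly \<open>M F / a\<close>. With this
  bound the constant term of the estimate is nearly the asserted limit, and the contribution of the
  difference at time \<open>s\<close> dies out.\<close>

lemma eventually_close:
  assumes p: "state_probabilities S q 0 p" "p 0 \<in> l1D S d"
    and p': "state_probabilities S q' 0 p'"
    and bd: "\<And>T. \<exists>U. \<forall>t\<in>{0..T}. wbound S d (\<lambda>k. p' t k - origin k) U"
    and \<epsilon>: "0 < \<epsilon>"
  shows "\<forall>\<^sub>F t in at_top. wbound S d (\<lambda>k. p t k - p' t k)
    (M * (M * \<Delta>B * F + a * \<Delta>f) / (a * (a - M * \<Delta>B)) + \<epsilon>)"
proof -
  define b where "b = a - M * \<Delta>B"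
  have b: "0 < b" using small by (simp add: b_def)
  define G where "G = M * (M * \<Delta>B * F + a * \<Delta>f) / (a * b)"
  have prob: "prob_vec S (p u)" if "0 \<le> u" for u
    using p that by (auto simp: state_probabilities_def)
  obtain R where R: "wbound S d (\<lambda>k. p 0 k - origin k) R"
    using p(2) l1D_iff[OF prob[OF order_refl]] by blast
  define K where "K \<equiv> \<lambda>s. M * exp (- a * s) * R + M * F / a"
  have K: "wbound S d (\<lambda>k. p t k - origin k) (K s)" if "0 \<le> s" "s \<le> t" for s t
  proof -
    have "wbound S d (\<lambda>k. p t k - origin k) (M * exp (- a * (t - 0)) * R + M * F / a)"
      using that by (intro solution_bound[OF order_refl _ p(1) R]) auto
    moreover have "M * exp (- a * (t - 0)) * R \<le> M * exp (- a * s) * R"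
      using that a_pos M_pos wbound_nonneg[OF R] by (intro mult_right_mono mult_left_mono) auto
    ultimately show ?thesis unfolding K_def by (auto intro: wbound_mono)
  qed
  have "((\<lambda>s. exp (- a * s)) \<longlongrightarrow> 0) at_top" using a_pos by real_asymp
  then have "((\<lambda>s. M * (\<Delta>B * K s + \<Delta>f) / b) \<longlongrightarrow> M * (\<Delta>B * (M * 0 * R + M * F / a) + \<Delta>f) / b) at_top"
    unfolding K_def using b by (intro tendsto_intros) auto
  also have "M * (\<Delta>B * (M * 0 * R + M * F / a) + \<Delta>f) / b = G"
    using a_pos b by (simp add: G_def field_simps)
  finally have "\<forall>\<^sub>F s in at_top. M * (\<Delta>B * K s + \<Delta>f) / b < G + \<epsilon> / 2"
    by (rule order_tendstoD) (use \<epsilon> in simp)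
  then have "\<forall>\<^sub>F s in at_top. 0 \<le> s \<and> M * (\<Delta>B * K s + \<Delta>f) / b < G + \<epsilon> / 2"
    using eventually_ge_at_top[of 0] by eventually_elim auto
  then obtain s where s: "0 \<le> s" "M * (\<Delta>B * K s + \<Delta>f) / b < G + \<epsilon> / 2"
    using eventually_happens by force
  have bds: "\<exists>U. \<forall>t\<in>{s..T}. wbound S d (\<lambda>k. p' t k - origin k) U" for T
    using bd[of T] s by (meson atLeastAtMost_iff order_trans)
  obtain U where U: "wbound S d (\<lambda>k. p' s k - origin k) U" using bds[of s] by auto
  define D where "D = K s + U"
  have D: "wbound S d (\<lambda>k. p s k - p' s k) D"
    using wbound_diff[OF K[OF s(1) order_refl] U] by (simp add: D_def)
  have "((\<lambda>t. M * exp (- b * (t - s)) * D) \<longlongrightarrow> 0) at_top"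
  proof -
    have "((\<lambda>t. exp (- b * (t - s))) \<longlongrightarrow> 0) at_top" using b by real_asymp
    from tendsto_mult[OF tendsto_mult[OF tendsto_const[of M] this] tendsto_const[of D]]
    show ?thesis by simp
  qed
  then have "\<forall>\<^sub>F t in at_top. M * exp (- b * (t - s)) * D < \<epsilon> / 2"
    by (rule order_tendstoD) (use \<epsilon> in simp)
  then have "\<forall>\<^sub>F t in at_top. wbound S d (\<lambda>k. p t k - p' t k) (G + \<epsilon>)"
    using eventually_ge_at_top[of s]
  proof eventually_elim
    case (elim t)
    have "wbound S d (\<lambda>k. p t k - p' t k) (M * exp (- b * (t - s)) * D + M * (\<Delta>B * K s + \<Delta>f) / b)"
      unfolding b_def using K s elim
      by (intro solution_perturbed_solution[OF s(1) _ state_probabilities_restart[OF p(1) s(1)]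
            state_probabilities_restart[OF p' s(1)] bds _ D]) auto
    then show ?case by (rule wbound_mono) (use elim s in linarith)
  qed
  then show ?thesis by (simp add: G_def b_def)
qed

end

section \<open>Means as sums of tail probabilities\<close>

text \<open>The probability of exceeding \<open>n\<close>; it is \<open>0\<close> once \<open>n\<close> is the last state.\<close>

definition tail_prob :: "enat \<Rightarrow> (nat \<Rightarrow> real) \<Rightarrow> nat \<Rightarrow> real" where
  "tail_prob S p n = (if Suc n \<in> pos_states S then 1 - cum p (Suc n) else 0)"

context tail_weights
begin

lemma sum_tail_le:
  assumes x: "wbound S d x K" and V: "0 < V" "\<And>i. i \<in> pos_states S \<Longrightarrow> V \<le> d i"
    and f: "\<And>n. \<bar>f n\<bar> \<le> (if Suc n \<in> pos_states S then \<bar>cum x (Suc n)\<bar> else 0)"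
  shows "(\<Sum>n<N. \<bar>f n\<bar>) \<le> K / V"
proof -
  let ?I = "{1..N} \<inter> pos_states S"
  have "V * (\<Sum>n<N. \<bar>f n\<bar>) \<le> V * (\<Sum>n<N. if Suc n \<in> pos_states S then \<bar>cum x (Suc n)\<bar> else 0)"
    using V f by (intro mult_left_mono sum_mono) auto
  also have "(\<Sum>n<N. if Suc n \<in> pos_states S then \<bar>cum x (Suc n)\<bar> else 0)
      = (\<Sum>i=1..N. if i \<in> pos_states S then \<bar>cum x i\<bar> else 0)"
    by (rule sum.reindex_bij_witness[of _ "\<lambda>i. i - 1" Suc]) auto
  also have "\<dots> = (\<Sum>i\<in>?I. \<bar>cum x i\<bar>)"
    by (simp add: sum.inter_restrict)
  also have "V * \<dots> \<le> (\<Sum>i\<in>?I. d i * \<bar>cum x i\<bar>)"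
    unfolding sum_distrib_left using V by (intro sum_mono mult_right_mono) auto
  also have "\<dots> \<le> K" by (intro wboundD[OF x]) auto
  finally show ?thesis using V by (simp add: le_divide_eq mult.commute)
qed

lemma tail_prob_summable:
  assumes p: "prob_vec S p" "p \<in> l1D S d"
  shows "summable (tail_prob S p)"
proof -
  obtain K where K: "wbound S d (\<lambda>k. p k - origin k) K" using p l1D_iff by blast
  have "\<bar>tail_prob S p n\<bar> \<le> (if Suc n \<in> pos_states S then \<bar>cum (\<lambda>k. p k - origin k) (Suc n)\<bar> else 0)"
    for n by (simp add: tail_prob_def cum_diff cum_origin abs_minus_commute)
  from sum_tail_le[OF K _ _ this, of 1] have "(\<Sum>n<N. \<bar>tail_prob S p n\<bar>) \<le> K / 1" for N
    using weight_ge_1 by simp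
  then have "summable (\<lambda>n. \<bar>tail_prob S p n\<bar>)"
    by (intro summableI_nonneg_bounded) auto
  then show ?thesis by (rule summable_rabs_cancel)
qed

text \<open>A mean is a sum of tail probabilities, and these are the coordinates that the weights \<open>d i\<close>
  multiply. Weights bounded below by \<open>V\<close> thus control differences of means with the factor \<open>1 / V\<close>.\<close>

lemma tail_sum_diff_le:
  assumes p: "tail_prob S p sums m" and p': "tail_prob S p' sums m'"
    and K: "wbound S d (\<lambda>k. p k - p' k) K"
    and V: "0 < V" "\<And>i. i \<in> pos_states S \<Longrightarrow> V \<le> d i"
  shows "\<bar>m - m'\<bar> \<le> K / V"
proof -
  let ?f = "\<lambda>n. tail_prob S p n - tail_prob S p' n"
  have f: "\<bar>?f n\<bar> \<le> (if Suc n \<in> pos_states S then \<bar>cum (\<lambda>k. p k - p' k) (Suc n)\<bar> else 0)" for n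
    by (simp add: tail_prob_def cum_diff abs_minus_commute)
  have le: "\<bar>\<Sum>n<N. ?f n\<bar> \<le> K / V" for N
    by (rule order_trans[OF sum_abs sum_tail_le[OF K V f]])
  have "(\<lambda>N. \<bar>\<Sum>n<N. ?f n\<bar>) \<longlonglongrightarrow> \<bar>m - m'\<bar>"
    using sums_diff[OF p p'] unfolding sums_def by (rule tendsto_rabs)
  then show ?thesis by (rule LIMSEQ_le_const2) (use le in auto)
qed

end

context inhom_ctmc
begin

context
  fixes k :: nat and t :: real
  assumes k: "k \<in> states S" and t: "0 \<le> t"
begin

lemma X_measurable: "X t \<in> measurable (Q k) (count_space UNIV)"
  by (rule measurable_compose[OF measurable_X[OF k t], of "\<lambda>x. x"]) simp

lemma X_in_states: "w \<in> space (Q k) \<Longrightarrow> X t w \<in> states S"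
  using measurable_space[OF measurable_X[OF k t]] by auto

lemma X_sets: "{w \<in> space (Q k). R (X t w)} \<in> sets (Q k)"
proof -
  have "X t -` Collect R \<inter> space (Q k) \<in> sets (Q k)"
    using X_measurable by (rule measurable_sets) auto
  also have "X t -` Collect R \<inter> space (Q k) = {w \<in> space (Q k). R (X t w)}" by auto
  finally show ?thesis .
qed

end

text \<open>The Markov property with an empty past and initial time \<open>0\<close> gives the one-dimensional
  distributions.\<close>

lemma prob_X_eq:
  assumes k: "k \<in> states S" and t: "0 \<le> t" and j: "j \<in> states S"
  shows "\<P>(w in Q k. X t w = j) = P 0 t k j"
proof -
  interpret prob_space "Q k" by (rule prob_space_Q[OF k])
  have "AE w in Q k. X 0 w = k"
    using start[OF k] prob_Collect_eq_1[OF X_sets[OF k order_refl, of "\<lambda>x. x = k"]] by blast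
  then have "\<P>(w in Q k. X t w = j) = \<P>(w in Q k. X 0 w = k \<and> X t w = j)"
    using X_sets[OF k order_refl, of "\<lambda>x. x = k"] X_sets[OF k t, of "\<lambda>x. x = j"]
    by (intro prob_eq_AE sets.sets_Collect_conj) auto
  also have "\<dots> = P 0 t k j"
    using markov[OF k finite.emptyI, of 0 t k j] start[OF k] k t j by simp
  finally show ?thesis .
qed

lemma prob_X_greater:
  assumes k: "k \<in> states S" and t: "0 \<le> t"
  shows "\<P>(w in Q k. n < X t w) = tail_prob S (P 0 t k) n"
proof (cases "Suc n \<in> pos_states S")
  case True
  interpret prob_space "Q k" by (rule prob_space_Q[OF k])
  let ?E = "\<lambda>j. {w \<in> space (Q k). X t w = j}"
  have "prob (\<Union>j\<in>{..<Suc n}. ?E j) = (\<Sum>j<Suc n. prob (?E j))"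
    by (intro finite_measure_finite_Union) (auto simp: disjoint_family_on_def intro: X_sets[OF k t])
  also have "\<dots> = cum (P 0 t k) (Suc n)"
    unfolding cum_def using pos_states_downward[OF True]
    by (intro sum.cong refl prob_X_eq[OF k t]) auto
  finally have "prob (space (Q k) - (\<Union>j\<in>{..<Suc n}. ?E j)) = 1 - cum (P 0 t k) (Suc n)"
    by (subst prob_compl) (auto intro!: sets.finite_UN X_sets[OF k t])
  also have "space (Q k) - (\<Union>j\<in>{..<Suc n}. ?E j) = {w \<in> space (Q k). n < X t w}"
    by (auto simp: less_Suc_eq_le not_less)
  finally show ?thesis using True by (simp add: tail_prob_def)
next
  case False
  have "{w \<in> space (Q k). n < X t w} = {}"
  proof (rule equals0I)
    fix w assume "w \<in> {w \<in> space (Q k). n < X t w}"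
    then have "Suc n \<in> states S"
      using states_downward[OF X_in_states[OF k t, of w], of "Suc n"] by auto
    with False show False by (simp add: pos_states_eq)
  qed
  then have "\<P>(w in Q k. n < X t w) = 0" by (metis measure_empty)
  then show ?thesis using False by (simp add: tail_prob_def)
qed

lemma mean_eq_tail_sum:
  assumes k: "k \<in> states S" and t: "0 \<le> t" and sm: "summable (tail_prob S (P 0 t k))"
  shows "integrable (Q k) (\<lambda>w. real (X t w))"
    and "tail_prob S (P 0 t k) sums mean_from Q X t k"
proof -
  interpret prob_space "Q k" by (rule prob_space_Q[OF k])
  have nn: "0 \<le> tail_prob S (P 0 t k) n" for n
    unfolding prob_X_greater[OF k t, symmetric] by simp
  have "(\<integral>\<^sup>+w. ennreal (real (X t w)) \<partial>Q k) = (\<Sum>n. emeasure (Q k) {w \<in> space (Q k). n < X t w})"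
    using nn_integral_nat_function[OF X_measurable[OF k t]] by (simp add: ennreal_of_nat_eq_real_of_nat)
  also have "\<dots> = (\<Sum>n. ennreal (tail_prob S (P 0 t k) n))"
    by (simp add: emeasure_eq_measure prob_X_greater[OF k t])
  also have "\<dots> = ennreal (\<Sum>n. tail_prob S (P 0 t k) n)"
    using sm nn by (rule suminf_ennreal2[rotated])
  finally have "has_bochner_integral (Q k) (\<lambda>w. real (X t w)) (\<Sum>n. tail_prob S (P 0 t k) n)"
    using X_measurable[OF k t] suminf_nonneg[OF sm nn]
    by (intro has_bochner_integral_nn_integral) auto
  then show "integrable (Q k) (\<lambda>w. real (X t w))" "tail_prob S (P 0 t k) sums mean_from Q X t k"
    using summable_sums[OF sm] by (auto simp: has_bochner_integral_iff mean_from_def)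
qed

end

context bounded_chain
begin

lemma mean_tail:
  assumes k: "k \<in> states S" and t: "0 \<le> t"
  shows "integrable (Q k) (\<lambda>w. real (X t w))"
    and "tail_prob S (P 0 t k) sums mean_from Q X t k"
proof -
  have "P 0 t k \<in> l1D S d"
    by (rule solution_in_l1D[OF order_refl t transition_forward[OF order_refl k]
          transition_l1D[OF order_refl k]])
  from mean_eq_tail_sum[OF k t tail_prob_summable[OF transition_prob_vec[OF order_refl t k] this]]
  show "integrable (Q k) (\<lambda>w. real (X t w))" "tail_prob S (P 0 t k) sums mean_from Q X t k" .
qed

text \<open>By ergodicity, the means from all initial states approach the mean from state \<open>0\<close>.\<close>

lemma limiting_mean_from_0:
  assumes erg: "exp_weakly_ergodic_1D S d q M a"
    and V: "0 < V" "\<And>i. i \<in> pos_states S \<Longrightarrow> V \<le> d i"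
  shows "limiting_mean S Q X (\<lambda>t. mean_from Q X t 0)"
  unfolding limiting_mean_def
proof (intro ballI conjI allI impI)
  fix k assume k: "k \<in> states S"
  show "integrable (Q k) (\<lambda>w. real (X t w))" if "0 \<le> t" for t
    by (rule mean_tail(1)[OF k that])
  have k0: "0 \<in> states S" by simp
  note l1 = transition_l1D[OF order_refl] and pv = transition_prob_vec[OF order_refl order_refl]
  obtain R where R: "wbound S d (\<lambda>i. P 0 0 k i - P 0 0 0 i) R"
    using l1D_diff[OF pv[OF k] l1[OF k] pv[OF k0] l1[OF k0]] ..
  have "\<bar>mean_from Q X t k - mean_from Q X t 0\<bar> \<le> M * exp (- a * t) * R / V" if t: "0 \<le> t" for t
  proof -
    have "wbound S d (\<lambda>i. P 0 t k i - P 0 t 0 i) (M * exp (- a * (t - 0)) * R)"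
      by (rule exp_weakly_ergodic_wbound[OF erg order_refl t transition_forward[OF order_refl k] l1[OF k]
            transition_forward[OF order_refl k0] l1[OF k0] R])
    from tail_sum_diff_le[OF mean_tail(2)[OF k t] mean_tail(2)[OF k0 t] this V] show ?thesis by simp
  qed
  then have "\<forall>\<^sub>F t in at_top. norm (\<bar>mean_from Q X t k - mean_from Q X t 0\<bar>) \<le> M * exp (- a * t) * R / V"
    by (intro eventually_mono[OF eventually_ge_at_top[of 0]]) auto
  moreover have "((\<lambda>t. M * exp (- a * t) * R / V) \<longlongrightarrow> 0) at_top"
  proof -
    have "0 < a" using erg by (simp add: exp_weakly_ergodic_1D_def)
    then have "((\<lambda>t. exp (- a * t)) \<longlongrightarrow> 0) at_top" by real_asymp
    from tendsto_mult[OF tendsto_mult[OF tendsto_const[of M] this] tendsto_const[of "R / V"]]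
    show ?thesis by simp
  qed
  ultimately show "((\<lambda>t. \<bar>mean_from Q X t k - mean_from Q X t 0\<bar>) \<longlongrightarrow> 0) at_top"
    by (rule Lim_null_comparison)
qed

end

section \<open>The perturbation theorem\<close>

lemma Limsup_le_ennreal:
  fixes f :: "real \<Rightarrow> ennreal"
  assumes "0 \<le> C" and "\<And>\<epsilon>. 0 < \<epsilon> \<Longrightarrow> \<forall>\<^sub>F t in at_top. f t \<le> ennreal (C + \<epsilon>)"
  shows "Limsup at_top f \<le> ennreal C"
proof (rule ennreal_le_epsilon)
  fix \<epsilon> :: real assume "0 < \<epsilon>"
  then have "Limsup at_top f \<le> ennreal (C + \<epsilon>)" by (intro Limsup_bounded assms(2))
  then show "Limsup at_top f \<le> ennreal C + ennreal \<epsilon>" using assms(1) \<open>0 < \<epsilon>\<close> by (simp add: ennreal_plus)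
qed

theorem theorem2:
  fixes S :: enat
    and d :: "nat \<Rightarrow> real"
    and q q' :: "nat \<Rightarrow> nat \<Rightarrow> real \<Rightarrow> real"
    and L L' :: real
    and P P' :: "real \<Rightarrow> real \<Rightarrow> nat \<Rightarrow> nat \<Rightarrow> real"
    and Q :: "nat \<Rightarrow> 'w measure" and X :: "real \<Rightarrow> 'w \<Rightarrow> nat"
    and Q' :: "nat \<Rightarrow> 'v measure" and X' :: "real \<Rightarrow> 'v \<Rightarrow> nat"
    and \<BB> \<ff> \<Delta>B \<Delta>f M a W :: real
  assumes d_ge_1: "1 \<le> d 1"
    and d_mono: "\<And>i. 1 \<le> i \<Longrightarrow> enat (Suc i) \<le> S \<Longrightarrow> d i \<le> d (Suc i)"
    and chain: "inhom_ctmc S q L P Q X"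
    and perturbed_chain: "inhom_ctmc S q' L' P' Q' X'"
    and nonneg: "0 \<le> \<BB>" "0 \<le> \<ff>" "0 \<le> \<Delta>B" "0 \<le> \<Delta>f"
    and B_bound: "AE t in lebesgue. 0 \<le> t \<longrightarrow> opnorm_1D S d (B_mat S q t) \<le> ennreal \<BB>"
    and f_bound: "AE t in lebesgue. 0 \<le> t \<longrightarrow> norm_1D S d (f_vec S q t) \<le> ennreal \<ff>"
    and B_perturbation: "AE t in lebesgue. 0 \<le> t \<longrightarrow>
          opnorm_1D S d (\<lambda>i j. B_mat S q t i j - B_mat S q' t i j) \<le> ennreal \<Delta>B"
    and f_perturbation: "AE t in lebesgue. 0 \<le> t \<longrightarrow>
          norm_1D S d (\<lambda>i. f_vec S q t i - f_vec S q' t i) \<le> ennreal \<Delta>f"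
    and ergodic: "exp_weakly_ergodic_1D S d q M a"
    and small_perturbation: "M * \<Delta>B < a"
    and W: "W = (INF i\<in>pos_states S. d i / real i)"
  shows "(\<exists>M' a'. exp_weakly_ergodic_1D S d q' M' a') \<and>
    (\<forall>p p'. state_probabilities S q 0 p \<and> state_probabilities S q' 0 p' \<and>
        p 0 \<in> l1D S d \<and> p' 0 \<in> l1D S d \<longrightarrow>
        Limsup at_top (\<lambda>t. norm_1D S d (\<lambda>i. p t i - p' t i))
          \<le> ennreal (M * (M * \<Delta>B * \<ff> + a * \<Delta>f) / (a * (a - M * \<Delta>B)))) \<and>
    (0 < W \<longrightarrow>
        (\<exists>\<phi>. limiting_mean S Q X \<phi>) \<and> (\<exists>\<phi>'. limiting_mean S Q' X' \<phi>') \<and>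
        (\<forall>\<phi> \<phi>'. limiting_mean S Q X \<phi> \<and> limiting_mean S Q' X' \<phi>' \<longrightarrow>
           Limsup at_top (\<lambda>t. ennreal \<bar>\<phi> t - \<phi>' t\<bar>)
             \<le> ennreal (M * (M * \<Delta>B * \<ff> + a * \<Delta>f) / (W * a * (a - M * \<Delta>B)))))"
proof -
  have weights: "1 \<le> d i" if "i \<in> pos_states S" for i
  proof -
    have "enat i \<le> S" "1 \<le> i" using that by (auto simp: pos_states_def)
    then show ?thesis
    proof (induction i)
      case (Suc i)
      show ?case
      proof (cases "i = 0")
        case False
        have "enat i \<le> S" using Suc.prems(1) by (meson Suc_n_not_le_n enat_ord_simps(1) nle_le order_trans)
        then show ?thesis using Suc.IH d_mono[of i] Suc.prems False by force
      qed (use d_ge_1 in simp)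
    qed simp
  qed
  interpret X: inhom_ctmc S q L P Q X by (rule chain)
  interpret X': inhom_ctmc S q' L' P' Q' X' by (rule perturbed_chain)
  interpret tail_weights S d by unfold_locales (rule weights)
  have gen: "AE u in lebesgue. 0 \<le> u \<longrightarrow> bounded_generator S d (A_mat S q u) \<BB> \<ff>"
    using X.AE_regular_rates B_bound f_bound
  proof eventually_elim
    case (elim u)
    show ?case
    proof
      assume u: "0 \<le> u"
      then have "regular_rates S q L u" using elim by simp
      from A_mat_null_sum[OF this] show "bounded_generator S d (A_mat S q u) \<BB> \<ff>"
        using elim u nonneg by (intro bounded_generatorI) (auto simp: B_mat_def[abs_def] f_vec_def[abs_def])
    qed
  qed
  have gen_diff: "AE u in lebesgue. 0 \<le> u \<longrightarrow>
      bounded_generator S d (\<lambda>k j. A_mat S q u k j - A_mat S q' u k j) \<Delta>B \<Delta>f"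
    using X.AE_regular_rates X'.AE_regular_rates B_perturbation f_perturbation
  proof eventually_elim
    case (elim u)
    show ?case
    proof
      assume u: "0 \<le> u"
      then have reg: "regular_rates S q L u" "regular_rates S q' L' u" using elim by auto
      have null: "null_sum S (\<lambda>k. A_mat S q u k j - A_mat S q' u k j)" if "j \<in> states S" for j
        using has_sum_diff_real[OF A_mat_null_sum[OF reg(1) that] A_mat_null_sum[OF reg(2) that]] by simp
      have "(\<lambda>i j. B_mat S q u i j - B_mat S q' u i j)
          = (\<lambda>i j. (A_mat S q u i j - A_mat S q' u i j) - (A_mat S q u i 0 - A_mat S q' u i 0))"
        by (simp add: B_mat_def fun_eq_iff)
      then show "bounded_generator S d (\<lambda>k j. A_mat S q u k j - A_mat S q' u k j) \<Delta>B \<Delta>f"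
        using elim u nonneg null by (intro bounded_generatorI) (auto simp: f_vec_def)
    qed
  qed
  interpret C: perturbed_chain S q L P Q X d \<BB> \<ff> M a q' L' \<Delta>B \<Delta>f
    by unfold_locales (use gen gen_diff nonneg ergodic small_perturbation X'.AE_regular_rates in auto)
  interpret C': bounded_chain S q' L' P' Q' X' d "\<BB> + \<Delta>B" "\<ff> + \<Delta>f"
    by unfold_locales (use C.perturbed_bounded_generator nonneg in auto)
  define b where "b = a - M * \<Delta>B"
  define G where "G = M * (M * \<Delta>B * \<ff> + a * \<Delta>f) / (a * b)"
  have b: "0 < b" using small_perturbation by (simp add: b_def)
  have G0: "0 \<le> G" using C.M_pos C.a_pos b nonneg by (simp add: G_def)
  have erg': "exp_weakly_ergodic_1D S d q' M b"
    unfolding b_def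
  proof (rule exp_weakly_ergodicI[OF C.M_pos])
    show "0 < a - M * \<Delta>B" using b by (simp add: b_def)
    fix s t p p' R assume st: "0 \<le> s" "s \<le> t"
      and p: "state_probabilities S q' s p" "state_probabilities S q' s p'"
      and l1: "p s \<in> l1D S d" "p' s \<in> l1D S d" and R: "wbound S d (\<lambda>k. p s k - p' s k) R"
    from C.perturbed_difference_decay[OF st p C'.solution_locally_bounded[OF st(1) p(1) l1(1)]
        C'.solution_locally_bounded[OF st(1) p(2) l1(2)] R]
    show "wbound S d (\<lambda>k. p t k - p' t k) (M * exp (- (a - M * \<Delta>B) * (t - s)) * R)" .
  qed
  have close: "\<forall>\<^sub>F t in at_top. wbound S d (\<lambda>k. p t k - p' t k) (G + \<epsilon>)"
    if "state_probabilities S q 0 p" "state_probabilities S q' 0 p'" "p 0 \<in> l1D S d" "p' 0 \<in> l1D S d"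
      and "0 < \<epsilon>" for p p' \<epsilon>
    using C.eventually_close[OF that(1,3,2) C'.solution_locally_bounded[OF order_refl that(2,4)] that(5)]
    by (simp add: G_def b_def)
  have lim: "Limsup at_top (\<lambda>t. norm_1D S d (\<lambda>i. p t i - p' t i)) \<le> ennreal G"
    if p: "state_probabilities S q 0 p" "state_probabilities S q' 0 p'" "p 0 \<in> l1D S d" "p' 0 \<in> l1D S d"
    for p p'
  proof (rule Limsup_le_ennreal[OF G0])
    fix \<epsilon> :: real assume \<epsilon>: "0 < \<epsilon>"
    show "\<forall>\<^sub>F t in at_top. norm_1D S d (\<lambda>i. p t i - p' t i) \<le> ennreal (G + \<epsilon>)"
      using close[OF p \<epsilon>] eventually_ge_at_top[of 0]
    proof eventually_elim
      case (elim t)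
      then have "null_sum S (\<lambda>k. p t k - p' t k)"
        using p by (intro prob_diff) (auto simp: state_probabilities_def)
      from norm_1D_le_iff[OF this, of "G + \<epsilon>"] show ?case using elim G0 \<epsilon> by simp
    qed
  qed
  have means: "(\<exists>\<phi>. limiting_mean S Q X \<phi>) \<and> (\<exists>\<phi>'. limiting_mean S Q' X' \<phi>') \<and>
      (\<forall>\<phi> \<phi>'. limiting_mean S Q X \<phi> \<and> limiting_mean S Q' X' \<phi>' \<longrightarrow>
        Limsup at_top (\<lambda>t. ennreal \<bar>\<phi> t - \<phi>' t\<bar>) \<le> ennreal (G / W))" if W0: "0 < W"
  proof -
    have Wd: "W \<le> d i" if i: "i \<in> pos_states S" for i
    proof -
      have "bdd_below ((\<lambda>i. d i / real i) ` pos_states S)"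
        using weights by (intro bdd_belowI2[where m = 0]) (force intro: divide_nonneg_nonneg)
      then have "W \<le> d i / real i" unfolding W using i by (rule cINF_lower)
      also have "\<dots> \<le> d i" using weights[OF i] i by (simp add: pos_states_def divide_le_eq mult_le_cancel_left1)
      finally show ?thesis .
    qed
    have bound: "Limsup at_top (\<lambda>t. ennreal \<bar>\<phi> t - \<phi>' t\<bar>) \<le> ennreal (G / W)"
      if \<phi>: "limiting_mean S Q X \<phi>" and \<phi>': "limiting_mean S Q' X' \<phi>'" for \<phi> \<phi>'
    proof (rule Limsup_le_ennreal)
      show "0 \<le> G / W" using G0 W0 by simp
      fix \<epsilon> :: real assume \<epsilon>: "0 < \<epsilon>"
      \<comment> \<open>A third of \<open>\<epsilon>\<close> for each of the distances \<open>\<phi>\<close> to mean, mean to mean, mean to \<open>\<phi>'\<close>; the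
        factor \<open>W\<close> cancels on passing from the norm to means.\<close>
      let ?e = "W * (\<epsilon> / 3)"
      have e: "0 < ?e" "0 < \<epsilon> / 3" using \<epsilon> W0 by auto
      have z: "0 \<in> states S" by simp
      have "\<forall>\<^sub>F t in at_top. \<bar>mean_from Q X t 0 - \<phi> t\<bar> < \<epsilon> / 3"
        using \<phi> z e(2) unfolding limiting_mean_def by (metis order_tendstoD(2))
      moreover have "\<forall>\<^sub>F t in at_top. \<bar>mean_from Q' X' t 0 - \<phi>' t\<bar> < \<epsilon> / 3"
        using \<phi>' z e(2) unfolding limiting_mean_def by (metis order_tendstoD(2))
      moreover have "\<forall>\<^sub>F t in at_top. wbound S d (\<lambda>k. P 0 t 0 k - P' 0 t 0 k) (G + ?e)"
        by (rule close[OF X.transition_forward[OF order_refl z] X'.transition_forward[OF order_refl z]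
              C.transition_l1D[OF order_refl z] C'.transition_l1D[OF order_refl z] e(1)])
      ultimately show "\<forall>\<^sub>F t in at_top. ennreal \<bar>\<phi> t - \<phi>' t\<bar> \<le> ennreal (G / W + \<epsilon>)"
        using eventually_ge_at_top[of 0]
      proof eventually_elim
        case (elim t)
        have "\<bar>mean_from Q X t 0 - mean_from Q' X' t 0\<bar> \<le> (G + ?e) / W"
          by (rule tail_sum_diff_le[OF C.mean_tail(2)[OF z elim(4)] C'.mean_tail(2)[OF z elim(4)]
                elim(3) W0 Wd])
        also have "(G + ?e) / W = G / W + \<epsilon> / 3" using W0 by (simp add: add_divide_distrib)
        finally show ?case using elim by (intro ennreal_leI) linarith
      qed
    qed
    show ?thesis
      using C.limiting_mean_from_0[OF ergodic W0 Wd] C'.limiting_mean_from_0[OF erg' W0 Wd] bound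
      by blast
  qed
  have "M * (M * \<Delta>B * \<ff> + a * \<Delta>f) / (a * (a - M * \<Delta>B)) = G"
    "M * (M * \<Delta>B * \<ff> + a * \<Delta>f) / (W * a * (a - M * \<Delta>B)) = G / W"
    by (simp_all add: G_def b_def mult_ac)
  then show ?thesis using erg' lim means by auto
qed

end
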